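(* Let $d=2$ and let $\mu$ be a probability measure on the set of subsets of $\{e_1,-e_1,e_2,-e_2\}\subset\mathbb{Z}^2$, with associated i.i.d. degenerate random environment $\mathcal{G}$ with law $\mathbb{P}$. Assume that $\mu(\mathcal{A}_{\{-e_1,e_2\}})=1$, $\mu(\mathcal{A}_{\{e_1,-e_2\}})=1$, $\mu(\mathcal{A}_{\{-e_1\}})>0$, $\mu(\mathcal{A}_{\{e_1\}})>0$, $\mu(\mathcal{A}_{\{e_2\}})>0$ and $\mu(\mathcal{A}_{\{-e_2\}})>0$. Let $x\in\mathbb{Z}^2$. (a) $\mathbb{P}$-almost surely one of the following holds: (i) $\bar{\mathcal{C}}_x=\mathbb{Z}^2$; (ii) there exists a decreasing forward lower blocking function $W:\mathbb{Z}\to\mathbb{Z}$ such that $\bar{\mathcal{C}}_x=W_{\ge}$; (iii) there exists a decreasing forward upper blocking function $W:\mathbb{Z}\to\mathbb{Z}$ such that $\bar{\mathcal{C}}_x=W_{\le}$. (b) Only one of (i), (ii), (iii) can have probability different from $0$.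
   Context: Let $e_1=(1,0)$, $e_2=(0,1)$, $\mathcal{E}=\{\pm e_1,\pm e_2\}$. The degenerate random environment $\mathcal{G}=\{\mathcal{G}_x\}_{x\in\mathbb{Z}^2}$ consists of i.i.d. random subsets $\mathcal{G}_x$ of $\mathcal{E}$ with law $\mu$; $\mathbb{P}=\mu^{\otimes\mathbb{Z}^2}$. For $E\subset\mathcal{E}$, $\mathcal{A}_E$ is the event that a $\mu$-distributed subset $\mathcal{G}_o$ satisfies $\mathcal{G}_o\cap E\ne\varnothing$. Write $x\to y$ if there are $n\ge0$ and $x=x_0,\dots,x_n=y$ with $x_{i+1}-x_i\in\mathcal{G}_{x_i}$ for $0\le i\le n-1$. $\mathcal{C}_x=\{y:x\to y\}$, and $\bar{\mathcal{C}}_x$ is the set of $z\in\mathbb{Z}^2$ such that every infinite nearest-neighbour self-avoiding path in $\mathbb{Z}^2$ starting at $z$ passes through $\mathcal{C}_x$. For $w:\mathbb{Z}\to\mathbb{Z}$, let $w_{\ge}=\{(n,m)\in\mathbb{Z}^2:m\ge w(n)\}$, and define $w_{\le}$, $w_{<}$, $w_{>}$ similarly. $w$ is a forward lower blocking function if no point of $w_{\ge}$ is connected (via $\to$) to a point of $w_{<}$; it is a forward upper blocking function if no point of $w_{\le}$ is connected to a point of $w_{>}$. "Decreasing" means non-increasing. *)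

theory Defs
  imports "HOL-Probability.Probability"
begin

type_synonym site = "int \<times> int"

definition e1 :: site where "e1 = (1, 0)"

definition e2 :: site where "e2 = (0, 1)"

definition unit_steps :: "site set" where
  "unit_steps = {e1, - e1, e2, - e2}"

definition is_step_law :: "site set measure \<Rightarrow> bool" where
  "is_step_law \<mu> \<longleftrightarrow> prob_space \<mu> \<and> sets \<mu> = sets (count_space (Pow unit_steps))"

text \<open>The event $\mathcal{A}_E$.\<close>

definition meets :: "site set \<Rightarrow> site set set" where
  "meets E = {G. G \<subseteq> unit_steps \<and> G \<inter> E \<noteq> {}}"

definition env_law :: "site set measure \<Rightarrow> (site \<Rightarrow> site set) measure" where
  "env_law \<mu> = PiM (UNIV :: site set) (\<lambda>_. \<mu>)"

definition connected_to :: "(site \<Rightarrow> site set) \<Rightarrow> site \<Rightarrow> site \<Rightarrow> bool" where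
  "connected_to \<G> x y \<longleftrightarrow>
     (\<exists>(n::nat) p. p 0 = x \<and> p n = y \<and> (\<forall>i<n. p (Suc i) - p i \<in> \<G> (p i)))"

definition cluster :: "(site \<Rightarrow> site set) \<Rightarrow> site \<Rightarrow> site set" where
  "cluster \<G> x = {y. connected_to \<G> x y}"

text \<open>Paths of the full lattice: the steps are not constrained by the environment.\<close>

definition infinite_sa_path :: "site \<Rightarrow> (nat \<Rightarrow> site) \<Rightarrow> bool" where
  "infinite_sa_path z p \<longleftrightarrow> p 0 = z \<and> inj p \<and> (\<forall>i. p (Suc i) - p i \<in> unit_steps)"

definition filled_cluster :: "(site \<Rightarrow> site set) \<Rightarrow> site \<Rightarrow> site set" where
  "filled_cluster \<G> x = {z. \<forall>p. infinite_sa_path z p \<longrightarrow> (\<exists>i. p i \<in> cluster \<G> x)}"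

definition region_ge :: "(int \<Rightarrow> int) \<Rightarrow> site set" where
  "region_ge w = {(n, m). m \<ge> w n}"

definition region_le :: "(int \<Rightarrow> int) \<Rightarrow> site set" where
  "region_le w = {(n, m). m \<le> w n}"

definition region_less :: "(int \<Rightarrow> int) \<Rightarrow> site set" where
  "region_less w = {(n, m). m < w n}"

definition region_greater :: "(int \<Rightarrow> int) \<Rightarrow> site set" where
  "region_greater w = {(n, m). m > w n}"

definition forward_lower_blocking :: "(site \<Rightarrow> site set) \<Rightarrow> (int \<Rightarrow> int) \<Rightarrow> bool" where
  "forward_lower_blocking \<G> w \<longleftrightarrow>
     \<not> (\<exists>a\<in>region_ge w. \<exists>b\<in>region_less w. connected_to \<G> a b)"

definition forward_upper_blocking :: "(site \<Rightarrow> site set) \<Rightarrow> (int \<Rightarrow> int) \<Rightarrow> bool" where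
  "forward_upper_blocking \<G> w \<longleftrightarrow>
     \<not> (\<exists>a\<in>region_le w. \<exists>b\<in>region_greater w. connected_to \<G> a b)"

definition fills_plane :: "(site \<Rightarrow> site set) \<Rightarrow> site \<Rightarrow> bool" where
  "fills_plane \<G> x \<longleftrightarrow> filled_cluster \<G> x = UNIV"

definition fills_above :: "(site \<Rightarrow> site set) \<Rightarrow> site \<Rightarrow> bool" where
  "fills_above \<G> x \<longleftrightarrow>
     (\<exists>W. antimono W \<and> forward_lower_blocking \<G> W \<and> filled_cluster \<G> x = region_ge W)"

definition fills_below :: "(site \<Rightarrow> site set) \<Rightarrow> site \<Rightarrow> bool" where
  "fills_below \<G> x \<longleftrightarrow>
     (\<exists>W. antimono W \<and> forward_upper_blocking \<G> W \<and> filled_cluster \<G> x = region_le W)"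

text \<open>Since \<^const>\<open>measure\<close> vanishes on non-measurable sets, a claim that such an event has
  probability zero is only meaningful together with its membership in \<open>sets (env_law \<mu>)\<close>.\<close>

definition env_event ::
    "site set measure \<Rightarrow> ((site \<Rightarrow> site set) \<Rightarrow> bool) \<Rightarrow> (site \<Rightarrow> site set) set" where
  "env_event \<mu> Q = {\<G> \<in> space (env_law \<mu>). Q \<G>}"

end

theory Submission
  imports Defs
begin

text \<open>From every site there is a north-west path and a south-east path. A north-west walk which
  prefers left and one which starts below it and prefers up use independent sites until they meet,
  and the distance between them is a random walk without upward drift; so they coalesce almost surely,
  and likewise to the south-east. Therefore a point which has a point of the cluster in its
  south-west quadrant and another one in its north-east quadrant is enclosed by paths of the cluster,
  and the complement of the filled cluster consists of the points with no cluster point to the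
  south-west (the lower gap) and those with no cluster point to the north-east (the upper gap).

  A nonempty lower gap at x forces a nonempty lower gap at every site to the right of x. By
  stationarity, nonemptiness is then shift invariant up to a null set, and mixing of the shift gives
  a zero-one law for each gap. Both gaps cannot be nonempty almost surely: shifting far along the
  diagonal would put the lower gap of one cluster above the upper gap of another one, although the
  two clusters meet. The two zero-one values therefore decide which of the three alternatives holds.\<close>

section \<open>Clusters and gaps\<close>

text \<open>The opposite preferences make the walks approach: for both of them the favoured step
  points towards the other walk. With equal preferences and a favoured step that is always open,
  they would stay parallel forever. If \<open>p\<close> and \<open>q\<close> are the probabilities
  that \<alpha> and \<beta> are open, the distance narrows with probability \<open>p * q\<close> and
  widens with probability \<open>(1 - p) * (1 - q)\<close>; since one of the two steps is almost
  surely open, \<open>p + q \<ge> 1\<close>, which excludes an outward drift. Independence comes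
  from levels: \<open>snd z - fst z\<close> grows by one at each north-west step, so walks that have
  not met read two distinct sites of one level, and afterwards only higher levels. Planarity enters
  without a curve theorem: the enclosing contour consists of monotone staircases, and its inside is
  described by the componentwise order alone. All almost sure facts are collected in
  \<open>good_env\<close>, which keeps the geometry deterministic. Measurability is a separate
  obstacle, because infinite paths and blocking functions are quantified over uncountable
  sets.\<close>

definition adv :: "site \<Rightarrow> site \<Rightarrow> (site \<Rightarrow> site set) \<Rightarrow> site \<Rightarrow> site" where
  "adv \<alpha> \<beta> \<G> z = (if \<alpha> \<in> \<G> z then z + \<alpha> else z + \<beta>)"

text \<open>One common step count \<open>n\<close> suffices: every step raises a level by one, so
  walks from one level can only meet after equally many steps.\<close>

definition coalesces :: "site \<Rightarrow> site \<Rightarrow> (site \<Rightarrow> site set) \<Rightarrow> site \<Rightarrow> site \<Rightarrow> bool" where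
  "coalesces \<alpha> \<beta> \<G> u v \<longleftrightarrow> (\<exists>n. (adv \<alpha> \<beta> \<G> ^^ n) u = (adv \<beta> \<alpha> \<G> ^^ n) v)"

definition diag :: "nat \<Rightarrow> site" where
  "diag D = (int D, int D)"

definition low_gap :: "(site \<Rightarrow> site set) \<Rightarrow> site \<Rightarrow> site set" where
  "low_gap \<G> x = {z. \<forall>y\<in>cluster \<G> x. \<not> y \<le> z}"

definition up_gap :: "(site \<Rightarrow> site set) \<Rightarrow> site \<Rightarrow> site set" where
  "up_gap \<G> x = {z. \<forall>y\<in>cluster \<G> x. \<not> z \<le> y}"

text \<open>The middle clause provides horizontal exits from every column, arbitrarily high and
  arbitrarily low. Both signs of \<open>e1\<close>, both vertical directions and both direction
  pairs are listed so that the predicate is stable under reflection through the origin.\<close>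

definition good_env :: "(site \<Rightarrow> site set) \<Rightarrow> bool" where
  "good_env \<G> \<longleftrightarrow>
    (\<forall>z. \<G> z \<subseteq> unit_steps \<and> \<G> z \<inter> {- e1, e2} \<noteq> {} \<and> \<G> z \<inter> {e1, - e2} \<noteq> {}) \<and>
    (\<forall>c b. \<forall>s\<in>{e1, - e1}. (\<exists>t\<le>b. s \<in> \<G> (c, t)) \<and> (\<exists>t\<ge>b. s \<in> \<G> (c, t))) \<and>
    (\<forall>D u. coalesces (- e1) e2 \<G> (u + diag D) u \<and> coalesces (- e2) e1 \<G> (u + diag D) u)"

lemma fst_snd_steps [simp]:
  "fst e1 = 1" "snd e1 = 0" "fst e2 = 0" "snd e2 = 1"
  "fst (diag D) = int D" "snd (diag D) = int D"
  by (simp_all add: e1_def e2_def diag_def)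

lemma site_le_iff: "(y::site) \<le> z \<longleftrightarrow> fst y \<le> fst z \<and> snd y \<le> snd z"
  by (simp add: less_eq_prod_def)

lemma site_eq_iff: "(y::site) = z \<longleftrightarrow> fst y = fst z \<and> snd y = snd z"
  by (simp add: prod_eq_iff)

lemma unit_steps_iff: "s \<in> unit_steps \<longleftrightarrow> s = e1 \<or> s = - e1 \<or> s = e2 \<or> s = - e2"
  by (auto simp: unit_steps_def)

lemma connected_to_refl: "connected_to \<G> x x"
  unfolding connected_to_def by (rule exI[of _ 0], rule exI[of _ "\<lambda>_. x"]) simp

lemma connected_to_step:
  assumes "connected_to \<G> x y" "z - y \<in> \<G> y"
  shows "connected_to \<G> x z"
proof -
  obtain n :: nat and p where p: "p 0 = x" "p n = y" "\<forall>i<n. p (Suc i) - p i \<in> \<G> (p i)"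
    using assms(1) by (auto simp: connected_to_def)
  let ?q = "p(Suc n := z)"
  have "?q 0 = x \<and> ?q (Suc n) = z \<and> (\<forall>i<Suc n. ?q (Suc i) - ?q i \<in> \<G> (?q i))"
    using p assms(2) by (auto simp: less_Suc_eq)
  then show ?thesis unfolding connected_to_def by blast
qed

lemma connected_to_induct [consumes 1, case_names refl step]:
  assumes "connected_to \<G> x y" "P x"
    and "\<And>y z. connected_to \<G> x y \<Longrightarrow> P y \<Longrightarrow> z - y \<in> \<G> y \<Longrightarrow> P z"
  shows "P y"
proof -
  obtain n :: nat and p where p: "p 0 = x" "p n = y" "\<forall>i<n. p (Suc i) - p i \<in> \<G> (p i)"
    using assms(1) by (auto simp: connected_to_def)
  have "k \<le> n \<Longrightarrow> connected_to \<G> x (p k) \<and> P (p k)" for k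
  proof (induction k)
    case 0
    then show ?case using p assms(2) by (simp add: connected_to_refl)
  next
    case (Suc k)
    then show ?case using p assms(3) connected_to_step by (metis Suc_le_lessD less_imp_le)
  qed
  then show ?thesis using p by auto
qed

lemma connected_to_trans:
  assumes "connected_to \<G> y z" "connected_to \<G> x y"
  shows "connected_to \<G> x z"
  using assms
proof (induction rule: connected_to_induct)
  case (step u v)
  then show ?case by (blast intro: connected_to_step)
qed

lemma cluster_refl [simp]: "x \<in> cluster \<G> x"
  by (simp add: cluster_def connected_to_refl)

lemma cluster_step: "s \<in> \<G> y \<Longrightarrow> y \<in> cluster \<G> x \<Longrightarrow> y + s \<in> cluster \<G> x"
  by (simp add: cluster_def) (rule connected_to_step, auto)

lemma cluster_mono: "y \<in> cluster \<G> x \<Longrightarrow> cluster \<G> y \<subseteq> cluster \<G> x"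
  unfolding cluster_def using connected_to_trans by blast

lemma connected_to_closed:
  assumes "connected_to \<G> a b" "a \<in> S" "\<And>y s. y \<in> S \<Longrightarrow> s \<in> \<G> y \<Longrightarrow> y + s \<in> S"
  shows "b \<in> S"
  using assms(1,2)
proof (induction rule: connected_to_induct)
  case (step y z)
  then show ?case using assms(3)[of y "z - y"] by simp
qed

lemma cluster_subset:
  assumes "x \<in> S" "\<And>y s. y \<in> S \<Longrightarrow> s \<in> \<G> y \<Longrightarrow> y + s \<in> S"
  shows "cluster \<G> x \<subseteq> S"
  unfolding cluster_def using connected_to_closed[of \<G> x _ S] assms by blast

lemma good_envD:
  assumes "good_env \<G>"
  shows "s \<in> \<G> z \<Longrightarrow> s = e1 \<or> s = - e1 \<or> s = e2 \<or> s = - e2"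
    and "- e1 \<in> \<G> z \<or> e2 \<in> \<G> z" "e1 \<in> \<G> z \<or> - e2 \<in> \<G> z"
    and "s \<in> {e1, - e1} \<Longrightarrow> \<exists>t\<le>b. s \<in> \<G> (c, t)" "s \<in> {e1, - e1} \<Longrightarrow> \<exists>t\<ge>b. s \<in> \<G> (c, t)"
    and "coalesces (- e1) e2 \<G> (u + diag D) u" "coalesces (- e2) e1 \<G> (u + diag D) u"
  using assms unfolding good_env_def unit_steps_def by blast+

text \<open>The fallback step in \<open>adv\<close> is taken without a test. For the four listed
  pairs one of the two steps is always open, so the fallback is an open step as well.\<close>

lemma good_env_adv:
  assumes "good_env \<G>" and "(\<alpha>, \<beta>) \<in> {(- e1, e2), (e2, - e1), (- e2, e1), (e1, - e2)}"
    and "y \<in> cluster \<G> x"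
  shows "(adv \<alpha> \<beta> \<G> ^^ n) y \<in> cluster \<G> x"
proof (induction n)
  case (Suc n)
  define z where "z = (adv \<alpha> \<beta> \<G> ^^ n) y"
  have "\<alpha> \<in> \<G> z \<or> \<beta> \<in> \<G> z"
    using assms(2) good_envD(2,3)[OF assms(1), of z] by auto
  then have "adv \<alpha> \<beta> \<G> z \<in> cluster \<G> x"
    using Suc[folded z_def] by (auto simp: adv_def intro: cluster_step)
  then show ?case by (simp add: z_def)
qed (use assms in simp)

section \<open>Reflection through the origin, which exchanges the two gaps\<close>

definition neg_env :: "(site \<Rightarrow> site set) \<Rightarrow> site \<Rightarrow> site set" where
  "neg_env \<G> z = {s. - s \<in> \<G> (- z)}"

lemma neg_neg_env [simp]: "neg_env (neg_env \<G>) = \<G>"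
  by (auto simp: neg_env_def)

lemma adv_neg_env: "(adv \<alpha> \<beta> (neg_env \<G>) ^^ n) z = - (adv (- \<alpha>) (- \<beta>) \<G> ^^ n) (- z)"
  by (induction n) (auto simp: adv_def neg_env_def)

text \<open>Reflection negates the directions and exchanges the upper and the lower walk. This turns
  the north-west pair \<open>(- e1, e2)\<close> into the south-east pair
  \<open>(- e2, e1)\<close>.\<close>

lemma coalesces_neg_env: "coalesces \<alpha> \<beta> (neg_env \<G>) u v \<longleftrightarrow> coalesces (- \<beta>) (- \<alpha>) \<G> (- v) (- u)"
  unfolding coalesces_def adv_neg_env by (metis neg_equal_iff_equal)

lemma cluster_neg_env_subset: "uminus ` cluster \<G> x \<subseteq> cluster (neg_env \<G>) (- x)"
proof -
  have "cluster \<G> x \<subseteq> {y. - y \<in> cluster (neg_env \<G>) (- x)}"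
  proof (rule cluster_subset)
    fix y s assume "y \<in> {y. - y \<in> cluster (neg_env \<G>) (- x)}" "s \<in> \<G> y"
    then show "y + s \<in> {y. - y \<in> cluster (neg_env \<G>) (- x)}"
      using cluster_step[of "- s" "neg_env \<G>" "- y" "- x"] by (simp add: neg_env_def)
  qed simp
  then show ?thesis by auto
qed

lemma cluster_neg_env: "y \<in> cluster (neg_env \<G>) (- x) \<longleftrightarrow> - y \<in> cluster \<G> x"
  using cluster_neg_env_subset[of \<G> x] cluster_neg_env_subset[of "neg_env \<G>" "- x"]
  by (metis (no_types, opaque_lifting) image_subset_iff minus_minus neg_neg_env)

lemma low_gap_neg_env: "z \<in> low_gap (neg_env \<G>) (- x) \<longleftrightarrow> - z \<in> up_gap \<G> x"
proof -
  have le: "- z \<le> y \<longleftrightarrow> - y \<le> z" for y :: site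
    by (auto simp: site_le_iff)
  have "(\<forall>y. - y \<in> cluster \<G> x \<longrightarrow> \<not> y \<le> z) \<longleftrightarrow> (\<forall>y. y \<in> cluster \<G> x \<longrightarrow> \<not> - y \<le> z)"
    by (metis minus_minus)
  then show ?thesis
    by (simp add: low_gap_def up_gap_def Ball_def cluster_neg_env le)
qed

lemma good_env_neg:
  assumes "good_env \<G>"
  shows "good_env (neg_env \<G>)"
  unfolding good_env_def
proof (intro conjI allI ballI)
  fix z
  show "neg_env \<G> z \<subseteq> unit_steps"
  proof
    fix s assume "s \<in> neg_env \<G> z"
    then have "- s \<in> \<G> (- z)" by (simp add: neg_env_def)
    from good_envD(1)[OF assms this] show "s \<in> unit_steps"
      unfolding unit_steps_iff by (metis minus_minus)
  qed
  show "neg_env \<G> z \<inter> {- e1, e2} \<noteq> {}" "neg_env \<G> z \<inter> {e1, - e2} \<noteq> {}"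
    using good_envD(2,3)[OF assms, of "- z"] by (auto simp: neg_env_def)
next
  fix c b s assume "s \<in> {e1, - e1}"
  then have *: "- s \<in> {e1, - e1}" by auto
  obtain t where "t \<ge> - b" "- s \<in> \<G> (- c, t)" using good_envD(5)[OF assms *] by blast
  then show "\<exists>t\<le>b. s \<in> neg_env \<G> (c, t)"
    by (intro exI[of _ "- t"]) (auto simp: neg_env_def)
  obtain t where "t \<le> - b" "- s \<in> \<G> (- c, t)" using good_envD(4)[OF assms *] by blast
  then show "\<exists>t\<ge>b. s \<in> neg_env \<G> (c, t)"
    by (intro exI[of _ "- t"]) (auto simp: neg_env_def)
next
  fix D u
  \<comment> \<open>The reflected starting points are again of the form \<open>w + diag D\<close>
    and \<open>w\<close>, now with \<open>w = - (u + diag D)\<close>.\<close>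
  have *: "- u = - (u + diag D) + diag D" by simp
  show "coalesces (- e1) e2 (neg_env \<G>) (u + diag D) u" "coalesces (- e2) e1 (neg_env \<G>) (u + diag D) u"
    unfolding coalesces_neg_env
    using good_envD(6,7)[OF assms, of "- (u + diag D)" D] unfolding *[symmetric] by auto
qed

section \<open>Shape and persistence of the lower gap\<close>

lemma unbounded_left:
  assumes "good_env \<G>" "(a, b) \<in> cluster \<G> x"
  shows "\<exists>b'. (a - 1, b') \<in> cluster \<G> x"
proof -
  obtain t where t: "t \<ge> b" "- e1 \<in> \<G> (a, t)" using good_envD(5)[OF assms(1)] by blast
  have left: "- e1 \<in> \<G> (a, b') \<Longrightarrow> (a, b') \<in> cluster \<G> x \<Longrightarrow> ?thesis" for b'
    using cluster_step[of "- e1" \<G> "(a, b')" x] by (auto simp: e1_def)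
  \<comment> \<open>Where the left step is closed the upward step is open, so the column can be
    climbed until a left step is open, at height \<open>t\<close> at the latest.\<close>
  have "(a, b') \<in> cluster \<G> x \<Longrightarrow> b' \<le> t \<Longrightarrow> ?thesis" for b'
  proof (induction "nat (t - b')" arbitrary: b')
    case 0
    then have "b' = t" by simp
    then show ?case using left t(2) 0 by blast
  next
    case (Suc n)
    from good_envD(2)[OF assms(1), of "(a, b')"] show ?case
    proof
      assume "- e1 \<in> \<G> (a, b')"
      then show ?thesis using left Suc(3) by blast
    next
      assume "e2 \<in> \<G> (a, b')"
      from cluster_step[OF this Suc(3)] have "(a, b' + 1) \<in> cluster \<G> x" by (simp add: e2_def)
      moreover have "n = nat (t - (b' + 1))" "b' + 1 \<le> t" using Suc(2) by linarith+
      ultimately show ?thesis using Suc(1) by blast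
    qed
  qed
  then show ?thesis using t assms by blast
qed

lemma unbounded_left':
  assumes "good_env \<G>"
  shows "\<exists>y\<in>cluster \<G> x. fst y \<le> n"
proof -
  have "\<exists>b. (fst x - int k, b) \<in> cluster \<G> x" for k
  proof (induction k)
    case 0
    show ?case by (rule exI[of _ "snd x"]) simp
  next
    case (Suc k)
    then obtain b where "(fst x - int k, b) \<in> cluster \<G> x" ..
    from unbounded_left[OF assms this] show ?case by (simp add: algebra_simps)
  qed
  then obtain b where "(fst x - int (nat (fst x - n)), b) \<in> cluster \<G> x" by blast
  then show ?thesis by (intro bexI) auto
qed

lemma low_gap_down: "z \<in> low_gap \<G> x \<Longrightarrow> z' \<le> z \<Longrightarrow> z' \<in> low_gap \<G> x"
  using order.trans[of _ z' z] by (auto simp: low_gap_def)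

text \<open>Take \<open>t \<le> m\<close> with an open left step at \<open>(c + 1, t)\<close>. A
  cluster point of column \<open>c + 1\<close> at height at most \<open>t\<close> could climb until
  a left step is open and would enter column \<open>c\<close> at height at most \<open>m\<close>,
  which the gap at \<open>(c, m)\<close> forbids.\<close>

lemma low_gap_right:
  assumes "good_env \<G>" "(c, m) \<in> low_gap \<G> x"
  shows "\<exists>m'. (c + 1, m') \<in> low_gap \<G> x"
proof -
  obtain t where t: "t \<le> m" "- e1 \<in> \<G> (c + 1, t)" using good_envD(4)[OF assms(1)] by blast
  have gap: "\<not> (fst y \<le> c \<and> snd y \<le> m)" if "y \<in> cluster \<G> x" for y
    using assms(2) that by (auto simp: low_gap_def site_le_iff)
  have no: "(c + 1, b) \<in> cluster \<G> x \<Longrightarrow> b \<le> t \<Longrightarrow> False" for b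
  proof (induction "nat (t - b)" arbitrary: b)
    case 0
    then show ?case using cluster_step[of "- e1" \<G> "(c + 1, t)" x] gap[of "(c, t)"] t by (auto simp: e1_def)
  next
    case (Suc n)
    from good_envD(2)[OF assms(1), of "(c + 1, b)"] show ?case
    proof
      assume "- e1 \<in> \<G> (c + 1, b)"
      from cluster_step[OF this Suc(3)] show False
        using gap[of "(c, b)"] Suc t by (auto simp: e1_def)
    next
      assume "e2 \<in> \<G> (c + 1, b)"
      from cluster_step[OF this Suc(3)] have "(c + 1, b + 1) \<in> cluster \<G> x" by (simp add: e2_def)
      moreover have "n = nat (t - (b + 1))" "b + 1 \<le> t" using Suc(2) by linarith+
      ultimately show False using Suc(1) by blast
    qed
  qed
  have "(c + 1, t) \<in> low_gap \<G> x"
    unfolding low_gap_def site_le_iff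
  proof (clarsimp)
    fix a b assume y: "(a, b) \<in> cluster \<G> x" "a \<le> c + 1" "b \<le> t"
    then have "a = c + 1" using gap[of "(a, b)"] t by force
    then show False using no y by blast
  qed
  then show ?thesis by blast
qed

text \<open>A step out of the complement of the gap goes left or down and starts outside the cluster,
  above or to the right of a point of it; north-west steps from that point end up in the gap.\<close>

lemma low_gap_blocking:
  assumes "good_env \<G>" "z \<notin> low_gap \<G> x" "s \<in> \<G> z"
  shows "z + s \<notin> low_gap \<G> x"
proof
  assume zs: "z + s \<in> low_gap \<G> x"
  then have gap: "\<not> y \<le> z + s" if "y \<in> cluster \<G> x" for y
    using that by (auto simp: low_gap_def)
  obtain y where y: "y \<in> cluster \<G> x" "y \<le> z"
    using assms(2) by (auto simp: low_gap_def)
  have zC: "z \<notin> cluster \<G> x" using cluster_step[of s \<G> z x] assms(3) gap by blast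
  have "s = - e1 \<or> s = - e2"
    using good_envD(1)[OF assms(1,3)] gap[OF y(1)] y(2) by (auto simp: site_le_iff)
  then show False
  proof
    assume s: "s = - e1"
    have "y \<in> cluster \<G> x \<Longrightarrow> y \<le> z \<Longrightarrow> False" for y
    proof (induction "nat (snd z - snd y)" arbitrary: y)
      case 0
      then have "y = z" using gap[OF 0(2)] s by (auto simp: site_le_iff site_eq_iff)
      then show ?case using zC 0 by blast
    next
      case (Suc n)
      from good_envD(2)[OF assms(1), of y] show False
      proof
        assume "- e1 \<in> \<G> y"
        from gap[OF cluster_step[OF this Suc(3)]] show False
          using Suc(4) s by (auto simp: site_le_iff)
      next
        assume "e2 \<in> \<G> y"
        moreover have "n = nat (snd z - snd (y + e2))" "y + e2 \<le> z"
          using Suc(2,4) by (simp_all add: site_le_iff)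
        ultimately show False using Suc(1) cluster_step Suc(3) by blast
      qed
    qed
    then show False using y by blast
  next
    assume s: "s = - e2"
    \<comment> \<open>Mirror image of the previous case: \<open>y\<close> lies in the row of
      \<open>z\<close>, a step down from it would enter the gap, and otherwise a step to the right
      brings it closer to \<open>z\<close>.\<close>
    have "y \<in> cluster \<G> x \<Longrightarrow> y \<le> z \<Longrightarrow> False" for y
    proof (induction "nat (fst z - fst y)" arbitrary: y)
      case 0
      then have "y = z" using gap[OF 0(2)] s by (auto simp: site_le_iff site_eq_iff)
      then show ?case using zC 0 by blast
    next
      case (Suc n)
      from good_envD(3)[OF assms(1), of y] show False
      proof
        assume "- e2 \<in> \<G> y"
        from gap[OF cluster_step[OF this Suc(3)]] show False
          using Suc(4) s by (auto simp: site_le_iff)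
      next
        assume "e1 \<in> \<G> y"
        moreover have "n = nat (fst z - fst (y + e1))" "y + e1 \<le> z"
          using Suc(2,4) by (simp_all add: site_le_iff)
        ultimately show False using Suc(1) cluster_step Suc(3) by blast
      qed
    qed
    then show False using y by blast
  qed
qed

text \<open>The complement of the gap of \<open>x\<close> is closed under steps, so the cluster of
  \<open>y\<close> stays inside it and each of its points dominates a point of the cluster of
  \<open>x\<close>. This compares clusters of sites that need not be connected.\<close>

lemma low_gap_antimono:
  assumes "good_env \<G>" "y \<notin> low_gap \<G> x"
  shows "low_gap \<G> x \<subseteq> low_gap \<G> y"
proof -
  have "cluster \<G> y \<subseteq> - low_gap \<G> x"
    using low_gap_blocking[OF assms(1)] assms(2) by (intro cluster_subset) auto
  then have "\<exists>y'\<in>cluster \<G> x. y' \<le> z" if "z \<in> cluster \<G> y" for z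
    using that by (auto simp: low_gap_def)
  then show ?thesis
    unfolding low_gap_def by (smt (verit) mem_Collect_eq order.trans subsetI)
qed

lemma low_gap_shift:
  assumes "good_env \<G>" "low_gap \<G> x \<noteq> {}"
  shows "low_gap \<G> (x + e1) \<noteq> {}"
proof -
  have "x + e1 \<notin> low_gap \<G> x"
    unfolding low_gap_def using cluster_refl[of x \<G>] by (force simp: site_le_iff)
  then show ?thesis using low_gap_antimono[OF assms(1)] assms(2) by blast
qed

text \<open>Reflection reverses the horizontal direction: the upper gap persists to the left, as the
  lower gap persists to the right.\<close>

lemma up_gap_shift:
  assumes "good_env \<G>" "up_gap \<G> x \<noteq> {}"
  shows "up_gap \<G> (x - e1) \<noteq> {}"
proof -
  have "low_gap (neg_env \<G>) (- x) \<noteq> {}"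
    using assms(2) low_gap_neg_env by (metis empty_iff equals0I minus_minus)
  from low_gap_shift[OF good_env_neg[OF assms(1)] this] show ?thesis
    using low_gap_neg_env[of _ \<G> "x - e1"] by force
qed

text \<open>The gap meets every column: to the left because it is closed downwards in the order, to
  the right by \<open>low_gap_right\<close>. It is bounded above in every column because the cluster
  extends arbitrarily far to the left. So each column has a lowest site outside the gap, and its
  height is \<open>W\<close>.\<close>

lemma low_gap_complement_region:
  assumes "good_env \<G>" "low_gap \<G> x \<noteq> {}"
  obtains W where "antimono W" "- low_gap \<G> x = region_ge W"
proof -
  obtain a b where ab: "(a, b) \<in> low_gap \<G> x" using assms(2) by fastforce
  have right: "\<exists>m. (a + int k, m) \<in> low_gap \<G> x" for k
  proof (induction k)
    case (Suc k)
    then show ?case using low_gap_right[OF assms(1)] by (fastforce simp: algebra_simps)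
  qed (use ab in auto)
  have lo: "\<exists>m. (n, m) \<in> low_gap \<G> x" for n
  proof (cases "n \<le> a")
    case True
    then show ?thesis using low_gap_down[OF ab, of "(n, b)"] by auto
  next
    case False
    then show ?thesis using right[of "nat (n - a)"] by auto
  qed
  have hi: "\<exists>m. (n, m) \<notin> low_gap \<G> x" for n
  proof -
    obtain y where "y \<in> cluster \<G> x" "fst y \<le> n" using unbounded_left'[OF assms(1)] by blast
    then have "(n, snd y) \<notin> low_gap \<G> x" by (force simp: low_gap_def site_le_iff)
    then show ?thesis by blast
  qed
  have "\<exists>w. \<forall>m. (n, m) \<in> low_gap \<G> x \<longleftrightarrow> m < w" for n
  proof -
    obtain l where l: "(n, l) \<in> low_gap \<G> x" using lo by blast
    obtain h where h: "(n, h) \<notin> low_gap \<G> x" using hi by blast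
    have down: "(n, m) \<in> low_gap \<G> x \<Longrightarrow> m' \<le> m \<Longrightarrow> (n, m') \<in> low_gap \<G> x" for m m'
      using low_gap_down[of "(n, m)" \<G> x "(n, m')"] by simp
    have "l \<le> h" using down[OF l, of h] h by linarith
    have "(n, l + int (nat (h - l))) \<notin> low_gap \<G> x" using h \<open>l \<le> h\<close> by simp
    then have ex: "\<exists>k. (n, l + int k) \<notin> low_gap \<G> x" by blast
    \<comment> \<open>The least height outside the gap is counted from a height \<open>l\<close>
      inside it, since a minimum over all integers need not exist.\<close>
    define k where "k = (LEAST k. (n, l + int k) \<notin> low_gap \<G> x)"
    have k: "(n, l + int k) \<notin> low_gap \<G> x" unfolding k_def by (rule LeastI_ex[OF ex])
    have k': "j < k \<Longrightarrow> (n, l + int j) \<in> low_gap \<G> x" for j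
      unfolding k_def using not_less_Least by blast
    have "(n, m) \<in> low_gap \<G> x \<longleftrightarrow> m < l + int k" for m
    proof
      assume "(n, m) \<in> low_gap \<G> x"
      then show "m < l + int k" using down k by (meson not_le)
    next
      assume m: "m < l + int k"
      show "(n, m) \<in> low_gap \<G> x"
      proof (cases "m \<le> l")
        case True
        then show ?thesis using down l by blast
      next
        case False
        then show ?thesis using k'[of "nat (m - l)"] m by auto
      qed
    qed
    then show ?thesis by blast
  qed
  then obtain W where W: "\<And>n m. (n, m) \<in> low_gap \<G> x \<longleftrightarrow> m < W n" by metis
  have "antimono W"
  proof (rule antimonoI)
    fix n n' :: int assume "n \<le> n'"
    then have "(n', m) \<in> low_gap \<G> x \<Longrightarrow> (n, m) \<in> low_gap \<G> x" for m
      using low_gap_down[of "(n', m)" \<G> x "(n, m)"] by simp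
    \<comment> \<open>\<open>W n' - 1\<close> is the highest gap site of column \<open>n'\<close>;
      it is a gap height of column \<open>n\<close> too, hence below \<open>W n\<close>.\<close>
    then show "W n' \<le> W n" using W[of n' "W n' - 1"] W[of n "W n' - 1"] by simp
  qed
  moreover have "- low_gap \<G> x = region_ge W"
    using W by (auto simp: region_ge_def not_less[symmetric])
  ultimately show ?thesis using that by blast
qed

section \<open>The filled cluster\<close>

definition stair :: "site set \<Rightarrow> site \<Rightarrow> site \<Rightarrow> bool" where
  "stair C a b \<longleftrightarrow> a \<in> C \<and> b \<in> C \<and> (b = a - e1 \<or> b = a + e2)"

lemma stair_le:
  assumes "(stair C)\<^sup>*\<^sup>* a b"
  shows "fst b \<le> fst a \<and> snd a \<le> snd b"
  using assms by induction (auto simp: stair_def)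

lemma stair_mem:
  assumes "(stair C)\<^sup>*\<^sup>* a b" "b \<in> C"
  shows "a \<in> C"
  using assms by (induction rule: converse_rtranclp_induct) (auto simp: stair_def)

text \<open>\<open>k\<close> ranges over the points of staircases in \<open>C\<close> from the south-east corner \<open>a\<close>
  to the north-west corner \<open>b\<close>.\<close>

definition between_stairs :: "site set \<Rightarrow> site \<Rightarrow> site \<Rightarrow> site set" where
  "between_stairs C a b = {k. (stair C)\<^sup>*\<^sup>* a k \<and> (stair C)\<^sup>*\<^sup>* k b}"

lemma between_stairs_next:
  assumes "k \<in> between_stairs C a b" "k \<noteq> b"
  shows "k - e1 \<in> between_stairs C a b \<or> k + e2 \<in> between_stairs C a b"
proof -
  have "(stair C)\<^sup>*\<^sup>* k b" using assms(1) by (simp add: between_stairs_def)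
  then obtain k' where "stair C k k'" "(stair C)\<^sup>*\<^sup>* k' b"
    using assms(2) by (metis converse_rtranclpE)
  then have "k' \<in> between_stairs C a b" using assms(1)
    by (auto simp: between_stairs_def intro: rtranclp.rtrancl_into_rtrancl)
  then show ?thesis using \<open>stair C k k'\<close> by (auto simp: stair_def)
qed

lemma between_stairs_prev:
  assumes "k \<in> between_stairs C a b" "k \<noteq> a"
  shows "k + e1 \<in> between_stairs C a b \<or> k - e2 \<in> between_stairs C a b"
proof -
  have "(stair C)\<^sup>*\<^sup>* a k" using assms(1) by (simp add: between_stairs_def)
  then obtain k' where "stair C k' k" "(stair C)\<^sup>*\<^sup>* a k'"
    using assms(2) by (metis rtranclp.cases)
  then have "k' \<in> between_stairs C a b" using assms(1)
    by (auto simp: between_stairs_def intro: converse_rtranclp_into_rtranclp)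
  then show ?thesis using \<open>stair C k' k\<close> by (auto simp: stair_def)
qed

lemma between_stairs_bounds:
  assumes "k \<in> between_stairs C a b"
  shows "fst b \<le> fst k" "fst k \<le> fst a" "snd a \<le> snd k" "snd k \<le> snd b"
  using stair_le[of C a k] stair_le[of C k b] assms by (simp_all add: between_stairs_def)

lemma between_stairs_subset:
  assumes "b \<in> C"
  shows "between_stairs C a b \<subseteq> C"
  using stair_mem[OF _ assms] by (auto simp: between_stairs_def)

text \<open>The order-convex hull of \<open>K\<close>. For two staircases with common ends it plays
  the part of the contour together with its inside.\<close>

definition enclosed :: "site set \<Rightarrow> site set" where
  "enclosed K = {z. (\<exists>k\<in>K. k \<le> z) \<and> (\<exists>k\<in>K. z \<le> k)}"

text \<open>A step endangers only one of the two witnesses. For \<open>e1\<close> this is an upper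
  witness straight above \<open>z\<close>: following its staircase towards \<open>a\<close>, either
  a step to the right gives a new witness, or a step down keeps an old one, which cannot reach
  \<open>z\<close> because \<open>z\<close> is not in \<open>K\<close>. The other three directions
  are symmetric.\<close>

lemma enclosed_neighbour:
  fixes a b z :: site and C :: "site set"
  defines "K \<equiv> between_stairs C a b"
  assumes z: "z \<in> enclosed K" "z \<notin> K" and s: "s \<in> unit_steps"
  shows "z + s \<in> enclosed K"
proof -
  obtain l where l: "l \<in> K" "l \<le> z" using z by (auto simp: enclosed_def)
  obtain h where h: "h \<in> K" "z \<le> h" using z by (auto simp: enclosed_def)
  note bl = between_stairs_bounds[OF l(1)[unfolded K_def]]
  note bh = between_stairs_bounds[OF h(1)[unfolded K_def]]
  have ne: "k \<in> K \<Longrightarrow> k \<noteq> z" for k using z by blast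
  consider "s = e1" | "s = - e1" | "s = e2" | "s = - e2" using s by (auto simp: unit_steps_iff)
  then show ?thesis
  proof cases
    case 1
    have "k \<in> K \<Longrightarrow> z \<le> k \<Longrightarrow> \<exists>k\<in>K. z + e1 \<le> k" for k
    proof (induction "nat (snd k - snd z)" arbitrary: k rule: less_induct)
      case less
      show ?case
      proof (cases "z + e1 \<le> k")
        case False
        then have k: "fst k = fst z" "snd k > snd z"
          using less(2,3) ne[OF less(2)] by (auto simp: site_le_iff site_eq_iff)
        \<comment> \<open>The corner \<open>a\<close> is no higher than \<open>l\<close>, hence no
          higher than \<open>z\<close>, whereas \<open>k\<close> is strictly above \<open>z\<close>;
          so the staircase continues from \<open>k\<close> towards \<open>a\<close>.\<close>
        then have "k \<noteq> a" using bl l by (auto simp: site_le_iff)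
        from between_stairs_prev[OF less(2)[unfolded K_def] this, folded K_def] show ?thesis
        proof
          assume "k + e1 \<in> K"
          then show ?thesis using k by (intro bexI) (auto simp: site_le_iff)
        next
          assume "k - e2 \<in> K"
          then show ?thesis using less(1)[of "k - e2"] k by (auto simp: site_le_iff)
        qed
      qed (use less in blast)
    qed
    then obtain k where "k \<in> K" "z + e1 \<le> k" using h by blast
    moreover have "l \<le> z + e1" using l by (auto simp: site_le_iff)
    ultimately show ?thesis using 1 l by (auto simp: enclosed_def)
  next
    case 2
    have "k \<in> K \<Longrightarrow> k \<le> z \<Longrightarrow> \<exists>k\<in>K. k \<le> z - e1" for k
    proof (induction "nat (snd z - snd k)" arbitrary: k rule: less_induct)
      case less
      show ?case
      proof (cases "k \<le> z - e1")
        case False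
        then have k: "fst k = fst z" "snd k < snd z"
          using less(2,3) ne[OF less(2)] by (auto simp: site_le_iff site_eq_iff)
        then have "k \<noteq> b" using bh h by (auto simp: site_le_iff)
        from between_stairs_next[OF less(2)[unfolded K_def] this, folded K_def] show ?thesis
        proof
          assume "k - e1 \<in> K"
          then show ?thesis using k by (intro bexI) (auto simp: site_le_iff)
        next
          assume "k + e2 \<in> K"
          then show ?thesis using less(1)[of "k + e2"] k by (auto simp: site_le_iff)
        qed
      qed (use less in blast)
    qed
    then obtain k where "k \<in> K" "k \<le> z - e1" using l by blast
    moreover have "z - e1 \<le> h" using h by (auto simp: site_le_iff)
    ultimately show ?thesis using 2 h by (auto simp: enclosed_def)
  next
    case 3
    have "k \<in> K \<Longrightarrow> z \<le> k \<Longrightarrow> \<exists>k\<in>K. z + e2 \<le> k" for k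
    proof (induction "nat (fst k - fst z)" arbitrary: k rule: less_induct)
      case less
      show ?case
      proof (cases "z + e2 \<le> k")
        case False
        then have k: "snd k = snd z" "fst k > fst z"
          using less(2,3) ne[OF less(2)] by (auto simp: site_le_iff site_eq_iff)
        then have "k \<noteq> b" using bl l by (auto simp: site_le_iff)
        from between_stairs_next[OF less(2)[unfolded K_def] this, folded K_def] show ?thesis
        proof
          assume "k + e2 \<in> K"
          then show ?thesis using k by (intro bexI) (auto simp: site_le_iff)
        next
          assume "k - e1 \<in> K"
          then show ?thesis using less(1)[of "k - e1"] k by (auto simp: site_le_iff)
        qed
      qed (use less in blast)
    qed
    then obtain k where "k \<in> K" "z + e2 \<le> k" using h by blast
    moreover have "l \<le> z + e2" using l by (auto simp: site_le_iff)
    ultimately show ?thesis using 3 l by (auto simp: enclosed_def)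
  next
    case 4
    have "k \<in> K \<Longrightarrow> k \<le> z \<Longrightarrow> \<exists>k\<in>K. k \<le> z - e2" for k
    proof (induction "nat (fst z - fst k)" arbitrary: k rule: less_induct)
      case less
      show ?case
      proof (cases "k \<le> z - e2")
        case False
        then have k: "snd k = snd z" "fst k < fst z"
          using less(2,3) ne[OF less(2)] by (auto simp: site_le_iff site_eq_iff)
        then have "k \<noteq> a" using bh h by (auto simp: site_le_iff)
        from between_stairs_prev[OF less(2)[unfolded K_def] this, folded K_def] show ?thesis
        proof
          assume "k - e2 \<in> K"
          then show ?thesis using k by (intro bexI) (auto simp: site_le_iff)
        next
          assume "k + e1 \<in> K"
          then show ?thesis using less(1)[of "k + e1"] k by (auto simp: site_le_iff)
        qed
      qed (use less in blast)
    qed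
    then obtain k where "k \<in> K" "k \<le> z - e2" using l by blast
    moreover have "z - e2 \<le> h" using h by (auto simp: site_le_iff)
    ultimately show ?thesis using 4 h by (auto simp: enclosed_def)
  qed
qed

text \<open>A path that avoids the cluster avoids the staircases, so it never leaves the enclosed
  set. That set lies in the box spanned by \<open>a\<close> and \<open>b\<close>, which is too small
  for an injective infinite path.\<close>

lemma enclosed_filled:
  assumes "b \<in> cluster \<G> x" "z \<in> enclosed (between_stairs (cluster \<G> x) a b)"
  shows "z \<in> filled_cluster \<G> x"
  unfolding filled_cluster_def
proof (clarify, rule ccontr)
  fix p assume p: "infinite_sa_path z p" and avoid: "\<nexists>i. p i \<in> cluster \<G> x"
  let ?K = "between_stairs (cluster \<G> x) a b"
  have enc: "p i \<in> enclosed ?K" for i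
  proof (induction i)
    case (Suc i)
    have "p i \<notin> ?K" using avoid between_stairs_subset[OF assms(1)] by blast
    moreover have "p (Suc i) - p i \<in> unit_steps" using p by (simp add: infinite_sa_path_def)
    ultimately show ?case using enclosed_neighbour[OF Suc] by fastforce
  qed (use p assms(2) in \<open>simp add: infinite_sa_path_def\<close>)
  have "enclosed ?K \<subseteq> {fst b..fst a} \<times> {snd a..snd b}"
  proof
    fix w assume "w \<in> enclosed ?K"
    then obtain k l where k: "k \<in> ?K" "k \<le> w" and l: "l \<in> ?K" "w \<le> l" by (auto simp: enclosed_def)
    show "w \<in> {fst b..fst a} \<times> {snd a..snd b}"
      using between_stairs_bounds[OF k(1)] between_stairs_bounds[OF l(1)] k(2) l(2)
      by (simp add: site_le_iff mem_Times_iff)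
  qed
  then have "finite (enclosed ?K)" by (rule finite_subset) simp
  moreover have "inj p" using p by (simp add: infinite_sa_path_def)
  ultimately show False
    using enc finite_subset[of "range p" "enclosed ?K"] finite_imageD[of p UNIV] by auto
qed

section \<open>From coalescing walks to enclosing staircases\<close>

definition adv_step :: "site \<Rightarrow> site \<Rightarrow> (site \<Rightarrow> site set) \<Rightarrow> site \<Rightarrow> site \<Rightarrow> bool" where
  "adv_step \<alpha> \<beta> \<G> a b \<longleftrightarrow> b = adv \<alpha> \<beta> \<G> a \<or> b = adv \<beta> \<alpha> \<G> a"

lemma adv_step_pow:
  "(adv_step \<alpha> \<beta> \<G>)\<^sup>*\<^sup>* y ((adv \<alpha> \<beta> \<G> ^^ n) y)"
  "(adv_step \<alpha> \<beta> \<G>)\<^sup>*\<^sup>* y ((adv \<beta> \<alpha> \<G> ^^ n) y)"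
  by (induction n; force simp: adv_step_def intro: rtranclp.rtrancl_into_rtrancl)+

lemma adv_pow_coords:
  "\<exists>j k. j + k = n \<and> (adv \<alpha> \<beta> \<G> ^^ n) y =
    (fst y + int j * fst \<alpha> + int k * fst \<beta>, snd y + int j * snd \<alpha> + int k * snd \<beta>)"
proof (induction n)
  case (Suc n)
  define z where "z = (adv \<alpha> \<beta> \<G> ^^ n) y"
  obtain j k where jk: "j + k = n"
    "z = (fst y + int j * fst \<alpha> + int k * fst \<beta>, snd y + int j * snd \<alpha> + int k * snd \<beta>)"
    using Suc unfolding z_def by blast
  have "(adv \<alpha> \<beta> \<G> ^^ Suc n) y = (if \<alpha> \<in> \<G> z then z + \<alpha> else z + \<beta>)"
    by (simp add: z_def adv_def[of \<alpha> \<beta> \<G> "(adv \<alpha> \<beta> \<G> ^^ n) y"])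
  moreover have "z + \<alpha> = (fst y + int (Suc j) * fst \<alpha> + int k * fst \<beta>,
      snd y + int (Suc j) * snd \<alpha> + int k * snd \<beta>)"
    "z + \<beta> = (fst y + int j * fst \<alpha> + int (Suc k) * fst \<beta>,
      snd y + int j * snd \<alpha> + int (Suc k) * snd \<beta>)"
    using jk(2) by (simp_all add: site_eq_iff algebra_simps)
  moreover have "Suc j + k = Suc n" "j + Suc k = Suc n" using jk(1) by simp_all
  ultimately show ?case by metis
qed simp

text \<open>\<open>coalesces\<close> only concerns two points on one diagonal. The point on the
  lower level is therefore advanced first, and the walks of \<open>coalesces\<close> are appended;
  \<open>adv_step\<close> admits both preferences so that these pieces can be joined.\<close>

lemma good_env_coalesce:
  assumes "good_env \<G>" "y \<le> y'" and dir: "(\<alpha>, \<beta>) \<in> {(- e1, e2), (- e2, e1)}"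
  shows "\<exists>m. (adv_step \<alpha> \<beta> \<G>)\<^sup>*\<^sup>* y m \<and> (adv_step \<alpha> \<beta> \<G>)\<^sup>*\<^sup>* y' m"
proof -
  have m: "coalesces \<alpha> \<beta> \<G> (u + diag D) u" for u D
    using dir good_envD(6,7)[OF assms(1), of u D] by auto
  have "\<exists>u v D. (adv_step \<alpha> \<beta> \<G>)\<^sup>*\<^sup>* y v \<and> (adv_step \<alpha> \<beta> \<G>)\<^sup>*\<^sup>* y' u \<and> u = v + diag D"
  proof -
    \<comment> \<open>The level difference of the two points; the sign selects
      \<open>snd - fst\<close> for the north-west pair and \<open>fst - snd\<close> for the
      south-east pair.\<close>
    define n where "n = (snd y' - fst y' - (snd y - fst y)) * (if \<alpha> = - e1 then 1 else - 1)"
    show ?thesis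
    proof (cases "n \<ge> 0")
      case True
      define v where "v = (adv \<beta> \<alpha> \<G> ^^ nat n) y"
      obtain j k where jk: "j + k = nat n" "v =
        (fst y + int j * fst \<beta> + int k * fst \<alpha>, snd y + int j * snd \<beta> + int k * snd \<alpha>)"
        using adv_pow_coords[of "nat n" \<beta> \<alpha> \<G> y] unfolding v_def by blast
      have "int j + int k = n" using jk(1) True by linarith
      \<comment> \<open>One coordinate of the walk never increases, so in it \<open>v\<close> stays
        below \<open>y'\<close>; on a common level the other coordinate then has the same
        nonnegative difference.\<close>
      then have "y' = v + diag (nat (fst y' - fst v))"
        using dir assms(2) jk(2) by (auto simp: site_le_iff site_eq_iff n_def)
      then show ?thesis using adv_step_pow(2)[of \<alpha> \<beta> \<G> y "nat n"] v_def by blast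
    next
      case False
      define u where "u = (adv \<alpha> \<beta> \<G> ^^ nat (- n)) y'"
      obtain j k where jk: "j + k = nat (- n)" "u =
        (fst y' + int j * fst \<alpha> + int k * fst \<beta>, snd y' + int j * snd \<alpha> + int k * snd \<beta>)"
        using adv_pow_coords[of "nat (- n)" \<alpha> \<beta> \<G> y'] unfolding u_def by blast
      have "int j + int k = - n" using jk(1) False by linarith
      then have "u = y + diag (nat (fst u - fst y))"
        using dir assms(2) jk(2) by (auto simp: site_le_iff site_eq_iff n_def)
      then show ?thesis using adv_step_pow(1)[of \<alpha> \<beta> \<G> y' "nat (- n)"] u_def by blast
    qed
  qed
  then obtain v D where vu: "(adv_step \<alpha> \<beta> \<G>)\<^sup>*\<^sup>* y v" "(adv_step \<alpha> \<beta> \<G>)\<^sup>*\<^sup>* y' (v + diag D)" by blast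
  obtain n where "(adv \<alpha> \<beta> \<G> ^^ n) (v + diag D) = (adv \<beta> \<alpha> \<G> ^^ n) v"
    using m unfolding coalesces_def by blast
  then show ?thesis
    using vu adv_step_pow[where \<alpha> = \<alpha> and \<beta> = \<beta> and \<G> = \<G>] by (metis rtranclp_trans)
qed

lemma adv_step_cluster:
  assumes "good_env \<G>" "(\<alpha>, \<beta>) \<in> {(- e1, e2), (- e2, e1)}" "y \<in> cluster \<G> x"
    and "(adv_step \<alpha> \<beta> \<G>) y z"
  shows "z \<in> cluster \<G> x \<and> (z = y + \<alpha> \<or> z = y + \<beta>)"
  using good_env_adv[OF assms(1) _ assms(3), where n = 1 and \<alpha> = \<alpha> and \<beta> = \<beta>]
    good_env_adv[OF assms(1) _ assms(3), where n = 1 and \<alpha> = \<beta> and \<beta> = \<alpha>] assms(2,4)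
  by (auto simp: adv_step_def adv_def split: if_splits)

lemma nw_chain:
  assumes "good_env \<G>" "y \<in> cluster \<G> x" "(adv_step (- e1) e2 \<G>)\<^sup>*\<^sup>* y z"
  shows "(stair (cluster \<G> x))\<^sup>*\<^sup>* y z \<and> z \<in> cluster \<G> x"
  using assms(3)
proof induction
  case (step u v)
  then have "v \<in> cluster \<G> x \<and> (v = u - e1 \<or> v = u + e2)"
    using adv_step_cluster[OF assms(1) _ _ step(2), of x] by simp
  then have "stair (cluster \<G> x) u v" using step by (auto simp: stair_def)
  with step \<open>v \<in> _ \<and> _\<close> show ?case by (auto intro: rtranclp.rtrancl_into_rtrancl)
qed (use assms in simp)

text \<open>\<open>stair\<close> points to the north-west, so a south-east walk traverses it
  backwards and the chain leads from \<open>z\<close> to \<open>y\<close>.\<close>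

lemma se_chain:
  assumes "good_env \<G>" "y \<in> cluster \<G> x" "(adv_step (- e2) e1 \<G>)\<^sup>*\<^sup>* y z"
  shows "(stair (cluster \<G> x))\<^sup>*\<^sup>* z y \<and> z \<in> cluster \<G> x"
  using assms(3)
proof induction
  case (step u v)
  then have "v \<in> cluster \<G> x \<and> (v = u - e2 \<or> v = u + e1)"
    using adv_step_cluster[OF assms(1) _ _ step(2), of x] by simp
  then have "stair (cluster \<G> x) v u" using step by (auto simp: stair_def)
  with step \<open>v \<in> _ \<and> _\<close> show ?case by (auto intro: converse_rtranclp_into_rtranclp)
qed (use assms in simp)

lemma filled_cluster_good:
  assumes "good_env \<G>"
  shows "filled_cluster \<G> x = - (low_gap \<G> x \<union> up_gap \<G> x)"
proof (intro set_eqI iffI)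
  fix z assume "z \<in> - (low_gap \<G> x \<union> up_gap \<G> x)"
  then obtain y y' where y: "y \<in> cluster \<G> x" "y' \<in> cluster \<G> x" "y \<le> z" "z \<le> y'"
    by (auto simp: low_gap_def up_gap_def)
  then have "y \<le> y'" by order
  obtain b where "(adv_step (- e1) e2 \<G>)\<^sup>*\<^sup>* y b" "(adv_step (- e1) e2 \<G>)\<^sup>*\<^sup>* y' b"
    using good_env_coalesce[OF assms \<open>y \<le> y'\<close>] by blast
  note b = nw_chain[OF assms y(1) this(1)] nw_chain[OF assms y(2) this(2)]
  obtain a where "(adv_step (- e2) e1 \<G>)\<^sup>*\<^sup>* y a" "(adv_step (- e2) e1 \<G>)\<^sup>*\<^sup>* y' a"
    using good_env_coalesce[OF assms \<open>y \<le> y'\<close>] by blast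
  note a = se_chain[OF assms y(1) this(1)] se_chain[OF assms y(2) this(2)]
  \<comment> \<open>Both \<open>y\<close> and \<open>y'\<close> lie on staircases from
    \<open>a\<close> to \<open>b\<close>, so they serve as the lower and the upper witness.\<close>
  have "z \<in> enclosed (between_stairs (cluster \<G> x) a b)"
    using a b y unfolding enclosed_def between_stairs_def by blast
  with b show "z \<in> filled_cluster \<G> x" using enclosed_filled by blast
next
  fix z assume z: "z \<in> filled_cluster \<G> x"
  \<comment> \<open>The two horizontal half-lines from \<open>z\<close> must hit the cluster; the
    left hit lies below \<open>z\<close> in the order, the right hit above it.\<close>
  have "infinite_sa_path z (\<lambda>i. z - (int i, 0))" "infinite_sa_path z (\<lambda>i. z + (int i, 0))"
    by (auto simp: infinite_sa_path_def inj_def unit_steps_iff site_eq_iff)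
  then obtain i j where "z - (int i, 0) \<in> cluster \<G> x" "z + (int j, 0) \<in> cluster \<G> x"
    using z by (fastforce simp: filled_cluster_def)
  then show "z \<in> - (low_gap \<G> x \<union> up_gap \<G> x)"
    unfolding low_gap_def up_gap_def by (force simp: site_le_iff)
qed

section \<open>The three alternatives in terms of the gaps\<close>

lemma fills_plane_if:
  assumes "good_env \<G>" "low_gap \<G> x = {}" "up_gap \<G> x = {}"
  shows "fills_plane \<G> x"
  using filled_cluster_good[OF assms(1)] assms(2,3) by (simp add: fills_plane_def)

lemma fills_above_if:
  assumes "good_env \<G>" "low_gap \<G> x \<noteq> {}" "up_gap \<G> x = {}"
  shows "fills_above \<G> x"
proof -
  obtain W where W: "antimono W" "- low_gap \<G> x = region_ge W"
    using low_gap_complement_region[OF assms(1,2)] .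
  have "b \<in> region_ge W" if "a \<in> region_ge W" "connected_to \<G> a b" for a b
    using connected_to_closed[OF that(2,1)] low_gap_blocking[OF assms(1)] W(2)[symmetric] by simp
  then have "forward_lower_blocking \<G> W"
    by (fastforce simp: forward_lower_blocking_def region_ge_def region_less_def)
  then show ?thesis
    using W filled_cluster_good[OF assms(1), of x] assms(3) by (auto simp: fills_above_def)
qed

lemma fills_below_if:
  assumes "good_env \<G>" "up_gap \<G> x \<noteq> {}" "low_gap \<G> x = {}"
  shows "fills_below \<G> x"
proof -
  have good': "good_env (neg_env \<G>)" using assms(1) by (rule good_env_neg)
  have "low_gap (neg_env \<G>) (- x) \<noteq> {}"
    using assms(2) low_gap_neg_env by (metis empty_iff equals0I minus_minus)
  then obtain V where V: "antimono V" "- low_gap (neg_env \<G>) (- x) = region_ge V"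
    using low_gap_complement_region[OF good'] by blast
  \<comment> \<open>The reflected boundary: the two sign changes together preserve the monotonicity
    of \<open>V\<close>.\<close>
  define W where "W n = - V (- n)" for n
  have reg: "- up_gap \<G> x = region_le W"
  proof (intro set_eqI)
    fix z :: site
    have "z \<in> - up_gap \<G> x \<longleftrightarrow> - z \<in> region_ge V"
      unfolding V(2)[symmetric] using low_gap_neg_env[of "- z"] by simp
    then show "z \<in> - up_gap \<G> x \<longleftrightarrow> z \<in> region_le W"
      by (cases z) (auto simp: region_ge_def region_le_def W_def)
  qed
  have "y + s \<in> - up_gap \<G> x" if "y \<in> - up_gap \<G> x" "s \<in> \<G> y" for y s
  proof -
    have "- y \<notin> low_gap (neg_env \<G>) (- x)" "- s \<in> neg_env \<G> (- y)"
      using that low_gap_neg_env[of "- y"] by (auto simp: neg_env_def)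
    from low_gap_blocking[OF good' this] show ?thesis
      using low_gap_neg_env[of "- y + - s" \<G> x] by (simp add: add.commute)
  qed
  then have "b \<in> region_le W" if "a \<in> region_le W" "connected_to \<G> a b" for a b
    using connected_to_closed[OF that(2,1)] reg by blast
  then have "forward_upper_blocking \<G> W"
    by (fastforce simp: forward_upper_blocking_def region_le_def region_greater_def)
  moreover have "antimono W"
    using V(1) by (auto simp: W_def antimono_def)
  ultimately show ?thesis
    using reg filled_cluster_good[OF assms(1), of x] assms(3) by (auto simp: fills_below_def)
qed

lemma fills_exclusive:
  "\<not> (fills_plane \<G> x \<and> fills_above \<G> x)"
  "\<not> (fills_plane \<G> x \<and> fills_below \<G> x)"
  "\<not> (fills_above \<G> x \<and> fills_below \<G> x)"
proof -
  have *: "(0, V 0 - 1) \<notin> region_ge V" "(0, V 0 + 1) \<notin> region_le V" for V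
    by (auto simp: region_ge_def region_le_def)
  have "region_ge V \<noteq> region_le W" for V W
  proof -
    have "(0, max (V 0) (W 0 + 1)) \<in> region_ge V" "(0, max (V 0) (W 0 + 1)) \<notin> region_le W"
      by (auto simp: region_ge_def region_le_def)
    then show ?thesis by blast
  qed
  then show "\<not> (fills_plane \<G> x \<and> fills_above \<G> x)" "\<not> (fills_plane \<G> x \<and> fills_below \<G> x)"
    "\<not> (fills_above \<G> x \<and> fills_below \<G> x)"
    using * unfolding fills_plane_def fills_above_def fills_below_def by (metis UNIV_I)+
qed

text \<open>The two clusters share a point \<open>z\<close>, and the cluster of \<open>z\<close>
  would have to avoid both closed quadrants south-west and north-east of \<open>w\<close>. From a
  point strictly north-west of \<open>w\<close> some south-east step is open, and conversely; each
  such step moves the level one closer to that of \<open>w\<close>, so the descent cannot go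
  on.\<close>

lemma gaps_disjoint:
  assumes "good_env \<G>" "w \<in> low_gap \<G> (x + diag k)"
  shows "w \<notin> up_gap \<G> x"
proof
  assume w: "w \<in> up_gap \<G> x"
  have le: "x \<le> x + diag k" by (simp add: site_le_iff)
  obtain z where z: "(adv_step (- e1) e2 \<G>)\<^sup>*\<^sup>* x z" "(adv_step (- e1) e2 \<G>)\<^sup>*\<^sup>* (x + diag k) z"
    using good_env_coalesce[OF assms(1) le] by blast
  have zC: "z \<in> cluster \<G> x" "z \<in> cluster \<G> (x + diag k)"
    using nw_chain[OF assms(1) _ z(1)] nw_chain[OF assms(1) _ z(2)] by auto
  have out: "\<not> y \<le> w" "\<not> w \<le> y" if "y \<in> cluster \<G> z" for y
    using that w assms(2) cluster_mono[OF zC(1)] cluster_mono[OF zC(2)]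
    by (auto simp: low_gap_def up_gap_def)
  have "y \<in> cluster \<G> z \<Longrightarrow> False" for y
  proof (induction "nat \<bar>snd y - fst y - (snd w - fst w)\<bar>" arbitrary: y rule: less_induct)
    case less
    consider "fst y < fst w" "snd y > snd w" | "fst y > fst w" "snd y < snd w"
      using out[OF less(2)] by (force simp: site_le_iff)
    then show False
    proof cases
      case 1
      have "e1 \<in> \<G> y \<or> - e2 \<in> \<G> y" using good_envD(3)[OF assms(1)] .
      then obtain s where s: "s \<in> \<G> y" "s = e1 \<or> s = - e2" by blast
      show False using less(1)[OF _ cluster_step[OF s(1) less(2)]] 1 s(2) by auto
    next
      case 2
      have "- e1 \<in> \<G> y \<or> e2 \<in> \<G> y" using good_envD(2)[OF assms(1)] .
      then obtain s where s: "s \<in> \<G> y" "s = - e1 \<or> s = e2" by blast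
      show False using less(1)[OF _ cluster_step[OF s(1) less(2)]] 2 s(2) by auto
    qed
  qed
  then show False using cluster_refl by blast
qed

section \<open>Measurability\<close>

text \<open>Koenig's lemma: one keeps to the lists that have extensions of every length. It replaces
  the quantifier over infinite self-avoiding paths by quantifiers over finite lists, which makes the
  filled cluster measurable.\<close>

lemma koenig_lists:
  fixes V :: "'a list \<Rightarrow> bool"
  assumes prefix: "\<And>xs ys. V (xs @ ys) \<Longrightarrow> V xs"
    and branching: "\<And>xs. finite {a. V (xs @ [a])}"
    and long: "\<And>n. \<exists>xs. length xs = n \<and> V xs"
  shows "\<exists>f. \<forall>n. V (map f [0..<n])"
proof -
  define ext where "ext xs \<longleftrightarrow> (\<forall>n. \<exists>ys. length ys = n \<and> V (xs @ ys))" for xs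
  have grow: "\<exists>a. ext (xs @ [a])" if "ext xs" for xs
  proof (rule ccontr)
    assume "\<nexists>a. ext (xs @ [a])"
    then have "\<forall>a. \<exists>n. \<forall>ys. length ys = n \<longrightarrow> \<not> V ((xs @ [a]) @ ys)" unfolding ext_def by blast
    then obtain N where N: "\<And>a ys. length ys = N a \<Longrightarrow> \<not> V ((xs @ [a]) @ ys)" by metis
    \<comment> \<open>\<open>m\<close> bounds the depths \<open>N a\<close> at which the finitely
      many children of \<open>xs\<close> die out. An extension by \<open>Suc m\<close> letters
      passes through one child and survives it by \<open>m\<close> letters, a contradiction.\<close>
    define m where "m = Max (insert 0 (N ` {a. V (xs @ [a])}))"
    obtain ys where ys: "length ys = Suc m" "V (xs @ ys)"
      using \<open>ext xs\<close> unfolding ext_def by blast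
    then obtain a zs where zs: "ys = a # zs" "length zs = m" by (cases ys) auto
    have a: "V (xs @ [a])" using ys zs prefix[of "xs @ [a]" zs] by simp
    then have "N a \<le> m" unfolding m_def using branching by (intro Max_ge) auto
    moreover have "V ((xs @ [a]) @ take (N a) zs)"
      using ys zs prefix[of "(xs @ [a]) @ take (N a) zs" "drop (N a) zs"] by simp
    ultimately show False using N[of "take (N a) zs" a] zs by simp
  qed
  have "\<exists>g. \<forall>n. (ext (g n) \<and> length (g n) = n) \<and> (\<exists>a. g (Suc n) = g n @ [a])"
  proof (rule dependent_nat_choice)
    show "\<exists>xs. ext xs \<and> length xs = 0" using long by (simp add: ext_def)
    show "\<exists>ys. (ext ys \<and> length ys = Suc n) \<and> (\<exists>a. ys = xs @ [a])" if xs: "ext xs \<and> length xs = n" for xs n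
    proof -
      obtain a where "ext (xs @ [a])" using grow xs by blast
      then show ?thesis using xs by (intro exI[of _ "xs @ [a]"]) auto
    qed
  qed
  then obtain g where g: "\<And>n. ext (g n)" "\<And>n. length (g n) = n" "\<And>n. \<exists>a. g (Suc n) = g n @ [a]"
    by blast
  have "g n = map (\<lambda>k. last (g (Suc k))) [0..<n]" for n
  proof (induction n)
    case 0
    then show ?case using g(2)[of 0] by simp
  next
    case (Suc n)
    then show ?case using g(3)[of n] by auto
  qed
  moreover have "V (g n)" for n using g(1)[of n] prefix unfolding ext_def by blast
  ultimately show ?thesis by metis
qed

definition sa_list :: "site \<Rightarrow> site set \<Rightarrow> site list \<Rightarrow> bool" where
  "sa_list z C xs \<longleftrightarrow> (xs \<noteq> [] \<longrightarrow> hd xs = z) \<and> distinct xs \<and> (\<forall>y\<in>set xs. y \<notin> C) \<and>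
    (\<forall>i. Suc i < length xs \<longrightarrow> xs ! Suc i - xs ! i \<in> unit_steps)"

lemma infinite_sa_path_iff_lists:
  "(\<exists>p. infinite_sa_path z p \<and> (\<forall>i. p i \<notin> C)) \<longleftrightarrow> (\<forall>n. \<exists>xs. length xs = n \<and> sa_list z C xs)"
proof
  assume "\<exists>p. infinite_sa_path z p \<and> (\<forall>i. p i \<notin> C)"
  then obtain p where p: "infinite_sa_path z p" "\<forall>i. p i \<notin> C" by blast
  have "sa_list z C (map p [0..<n])" for n
    using p by (auto simp: sa_list_def infinite_sa_path_def hd_map distinct_map inj_on_def)
  then show "\<forall>n. \<exists>xs. length xs = n \<and> sa_list z C xs" by (metis length_map length_upt diff_zero)
next
  assume "\<forall>n. \<exists>xs. length xs = n \<and> sa_list z C xs"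
  moreover have "sa_list z C xs" if "sa_list z C (xs @ ys)" for xs ys
    unfolding sa_list_def
  proof (intro conjI allI impI)
    fix i assume "Suc i < length xs"
    then have "(xs @ ys) ! Suc i - (xs @ ys) ! i \<in> unit_steps"
      using that unfolding sa_list_def by (metis length_append trans_less_add1)
    with \<open>Suc i < length xs\<close> show "xs ! Suc i - xs ! i \<in> unit_steps" by (simp add: nth_append)
  qed (use that in \<open>auto simp: sa_list_def\<close>)
  moreover have "finite {a. sa_list z C (xs @ [a])}" for xs
  proof (rule finite_subset)
    show "{a. sa_list z C (xs @ [a])} \<subseteq> insert z ((+) (last xs) ` unit_steps)"
    proof
      fix a assume "a \<in> {a. sa_list z C (xs @ [a])}"
      then have a: "xs = [] \<longrightarrow> a = z"
        "\<forall>i. Suc i < length (xs @ [a]) \<longrightarrow> (xs @ [a]) ! Suc i - (xs @ [a]) ! i \<in> unit_steps"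
        by (auto simp only: sa_list_def) simp
      show "a \<in> insert z ((+) (last xs) ` unit_steps)"
      proof (cases "xs = []")
        case False
        then have "a - last xs \<in> unit_steps"
          using a(2)[THEN spec, of "length xs - 1"] by (simp add: nth_append last_conv_nth)
        then have "a \<in> (+) (last xs) ` unit_steps" by (intro image_eqI[of _ _ "a - last xs"]) auto
        then show ?thesis by (rule insertI2)
      qed (use a in blast)
    qed
  qed (simp add: unit_steps_def)
  ultimately obtain f where f: "\<And>n. sa_list z C (map f [0..<n])"
    using koenig_lists[of "sa_list z C"] by metis
  have "infinite_sa_path z f"
    unfolding infinite_sa_path_def
  proof (intro conjI allI)
    show "f 0 = z" using f[of 1] by (simp add: sa_list_def)
    show "inj f"
    proof (rule linorder_injI)
      fix i j :: nat assume "i < j"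
      moreover have "inj_on f {0..<Suc j}"
        using f[of "Suc j"] unfolding sa_list_def distinct_map by (simp del: upt_Suc)
      ultimately show "f i \<noteq> f j" by (auto dest: inj_onD)
    qed
    show "f (Suc i) - f i \<in> unit_steps" for i
    proof -
      have "map f [0..<Suc (Suc i)] ! Suc i - map f [0..<Suc (Suc i)] ! i \<in> unit_steps"
        using f[of "Suc (Suc i)"] unfolding sa_list_def by simp
      moreover have "map f [0..<Suc (Suc i)] ! Suc i = f (Suc i)" "map f [0..<Suc (Suc i)] ! i = f i"
        by (simp_all del: upt_Suc)
      ultimately show ?thesis by simp
    qed
  qed
  moreover have "f i \<notin> C" for i using f[of "Suc i"] by (auto simp: sa_list_def)
  ultimately show "\<exists>p. infinite_sa_path z p \<and> (\<forall>i. p i \<notin> C)" by blast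
qed

lemma mem_filled_cluster_iff:
  "z \<in> filled_cluster \<G> x \<longleftrightarrow>
    \<not> (\<forall>n. \<exists>xs. length xs = n \<and> sa_list z {} xs \<and> (\<forall>y\<in>set xs. \<not> connected_to \<G> x y))"
proof -
  have "z \<in> filled_cluster \<G> x \<longleftrightarrow> \<not> (\<exists>p. infinite_sa_path z p \<and> (\<forall>i. p i \<notin> cluster \<G> x))"
    unfolding filled_cluster_def by blast
  moreover have "sa_list z (cluster \<G> x) xs \<longleftrightarrow>
      sa_list z {} xs \<and> (\<forall>y\<in>set xs. \<not> connected_to \<G> x y)" for xs
    unfolding sa_list_def cluster_def by blast
  ultimately show ?thesis unfolding infinite_sa_path_iff_lists by simp
qed

text \<open>Eliminates the uncountable quantifier over \<open>W\<close>: choice assembles the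
  function from its columns, and only integer quantifiers remain.\<close>

lemma region_function_ge:
  "(\<exists>W. antimono W \<and> F = region_ge W) \<longleftrightarrow>
    (\<forall>n. \<exists>w. \<forall>m. (n, m) \<in> F \<longleftrightarrow> w \<le> m) \<and> (\<forall>n n' m. n \<le> n' \<longrightarrow> (n, m) \<in> F \<longrightarrow> (n', m) \<in> F)"
  (is "?L \<longleftrightarrow> ?R")
proof
  assume ?L
  then obtain W where W: "antimono W" "F = region_ge W" by blast
  show ?R unfolding W(2) region_ge_def using antimonoD[OF W(1)] by (auto intro: order_trans)
next
  assume R: ?R
  then obtain W where W: "\<And>n m. (n, m) \<in> F \<longleftrightarrow> W n \<le> m" by metis
  have "antimono W" using R W by (intro antimonoI) blast
  moreover have "F = region_ge W" using W by (auto simp: region_ge_def)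
  ultimately show ?L by blast
qed

lemma region_function_le:
  "(\<exists>W. antimono W \<and> F = region_le W) \<longleftrightarrow>
    (\<forall>n. \<exists>w. \<forall>m. (n, m) \<in> F \<longleftrightarrow> m \<le> w) \<and> (\<forall>n n' m. n' \<le> n \<longrightarrow> (n, m) \<in> F \<longrightarrow> (n', m) \<in> F)"
  (is "?L \<longleftrightarrow> ?R")
proof
  assume ?L
  then obtain W where W: "antimono W" "F = region_le W" by blast
  show ?R unfolding W(2) region_le_def using antimonoD[OF W(1)] by (auto intro: order_trans)
next
  assume R: ?R
  then obtain W where W: "\<And>n m. (n, m) \<in> F \<longleftrightarrow> m \<le> W n" by metis
  have "antimono W" using R W by (intro antimonoI) blast
  moreover have "F = region_le W" using W by (auto simp: region_le_def)
  ultimately show ?L by blast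
qed

text \<open>Blocking depends on \<open>W\<close> only through its region, which is the filled
  cluster in the case at hand; thus \<open>W\<close> disappears from this condition too.\<close>

lemma forward_blocking_iff:
  "forward_lower_blocking \<G> W \<longleftrightarrow> (\<forall>a b. a \<in> region_ge W \<longrightarrow> connected_to \<G> a b \<longrightarrow> b \<in> region_ge W)"
  "forward_upper_blocking \<G> W \<longleftrightarrow> (\<forall>a b. a \<in> region_le W \<longrightarrow> connected_to \<G> a b \<longrightarrow> b \<in> region_le W)"
proof -
  have "region_less W = - region_ge W" "region_greater W = - region_le W"
    by (auto simp: region_less_def region_ge_def region_greater_def region_le_def)
  then show
    "forward_lower_blocking \<G> W \<longleftrightarrow> (\<forall>a b. a \<in> region_ge W \<longrightarrow> connected_to \<G> a b \<longrightarrow> b \<in> region_ge W)"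
    "forward_upper_blocking \<G> W \<longleftrightarrow> (\<forall>a b. a \<in> region_le W \<longrightarrow> connected_to \<G> a b \<longrightarrow> b \<in> region_le W)"
    unfolding forward_lower_blocking_def forward_upper_blocking_def by blast+
qed

lemma fills_above_iff:
  "fills_above \<G> x \<longleftrightarrow>
    (\<forall>n. \<exists>w. \<forall>m. (n, m) \<in> filled_cluster \<G> x \<longleftrightarrow> w \<le> m) \<and>
    (\<forall>n n' m. n \<le> n' \<longrightarrow> (n, m) \<in> filled_cluster \<G> x \<longrightarrow> (n', m) \<in> filled_cluster \<G> x) \<and>
    (\<forall>a b. a \<in> filled_cluster \<G> x \<longrightarrow> connected_to \<G> a b \<longrightarrow> b \<in> filled_cluster \<G> x)"
proof -
  have "fills_above \<G> x \<longleftrightarrow> (\<exists>W. (antimono W \<and> filled_cluster \<G> x = region_ge W) \<and>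
    (\<forall>a b. a \<in> filled_cluster \<G> x \<longrightarrow> connected_to \<G> a b \<longrightarrow> b \<in> filled_cluster \<G> x))"
    unfolding fills_above_def forward_blocking_iff
    by (rule ex_cong1, rule iffI; elim conjE; simp only: simp_thms)
  then show ?thesis unfolding ex_simps unfolding region_function_ge unfolding conj_assoc .
qed

lemma fills_below_iff:
  "fills_below \<G> x \<longleftrightarrow>
    (\<forall>n. \<exists>w. \<forall>m. (n, m) \<in> filled_cluster \<G> x \<longleftrightarrow> m \<le> w) \<and>
    (\<forall>n n' m. n' \<le> n \<longrightarrow> (n, m) \<in> filled_cluster \<G> x \<longrightarrow> (n', m) \<in> filled_cluster \<G> x) \<and>
    (\<forall>a b. a \<in> filled_cluster \<G> x \<longrightarrow> connected_to \<G> a b \<longrightarrow> b \<in> filled_cluster \<G> x)"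
proof -
  have "fills_below \<G> x \<longleftrightarrow> (\<exists>W. (antimono W \<and> filled_cluster \<G> x = region_le W) \<and>
    (\<forall>a b. a \<in> filled_cluster \<G> x \<longrightarrow> connected_to \<G> a b \<longrightarrow> b \<in> filled_cluster \<G> x))"
    unfolding fills_below_def forward_blocking_iff
    by (rule ex_cong1, rule iffI; elim conjE; simp only: simp_thms)
  then show ?thesis unfolding ex_simps unfolding region_function_le unfolding conj_assoc .
qed

text \<open>Recursion on the length replaces the quantifier over path functions by countably many
  quantifiers over single sites.\<close>

fun reach_in :: "(site \<Rightarrow> site set) \<Rightarrow> site \<Rightarrow> nat \<Rightarrow> site \<Rightarrow> bool" where
  "reach_in \<G> x 0 y \<longleftrightarrow> x = y"
| "reach_in \<G> x (Suc n) y \<longleftrightarrow> (\<exists>z. reach_in \<G> x n z \<and> y - z \<in> \<G> z)"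

lemma connected_to_iff_reach_in: "connected_to \<G> x y \<longleftrightarrow> (\<exists>n. reach_in \<G> x n y)"
proof
  assume "connected_to \<G> x y"
  then show "\<exists>n. reach_in \<G> x n y"
  proof (induction rule: connected_to_induct)
    case refl
    show ?case by (rule exI[of _ 0]) simp
  next
    case (step y z)
    then obtain n where "reach_in \<G> x n y" by blast
    with step.hyps have "reach_in \<G> x (Suc n) z" unfolding reach_in.simps by blast
    then show ?case by blast
  qed
next
  have "reach_in \<G> x n y \<Longrightarrow> connected_to \<G> x y" for n
    by (induction n arbitrary: y) (auto simp: connected_to_refl intro: connected_to_step)
  then show "\<exists>n. reach_in \<G> x n y \<Longrightarrow> connected_to \<G> x y" by blast
qed

section \<open>Events of the random environment\<close>

locale step_law =
  fixes \<mu> :: "site set measure"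
  assumes law: "is_step_law \<mu>"
begin

sublocale \<mu>: prob_space \<mu>
  using law by (simp add: is_step_law_def)

lemma sets_mu: "A \<in> sets \<mu> \<longleftrightarrow> A \<subseteq> Pow unit_steps"
  using law by (simp add: is_step_law_def)

lemma space_mu: "space \<mu> = Pow unit_steps"
  using law sets_eq_imp_space_eq[of \<mu> "count_space (Pow unit_steps)"] by (simp add: is_step_law_def)

sublocale prob_space "env_law \<mu>"
  unfolding env_law_def by (intro prob_space_PiM \<mu>.prob_space_axioms)

lemma space_env: "\<G> \<in> space (env_law \<mu>) \<longleftrightarrow> (\<forall>z. \<G> z \<subseteq> unit_steps)"
  by (auto simp: env_law_def space_PiM space_mu PiE_iff)

lemma measurable_site_set: "A \<subseteq> Pow unit_steps \<Longrightarrow> {\<G> \<in> space (env_law \<mu>). \<G> z \<in> A} \<in> sets (env_law \<mu>)"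
  unfolding env_law_def
  by (intro measurable_sets_Collect[OF measurable_component_singleton] sets_mu[THEN iffD2]) auto

lemma measurable_site [measurable]: "Measurable.pred (env_law \<mu>) (\<lambda>\<G>. s \<in> \<G> z)"
proof -
  have "{\<G> \<in> space (env_law \<mu>). s \<in> \<G> z} = {\<G> \<in> space (env_law \<mu>). \<G> z \<in> {S \<in> Pow unit_steps. s \<in> S}}"
    unfolding space_env by blast
  then show ?thesis using measurable_site_set[of "{S \<in> Pow unit_steps. s \<in> S}" z]
    unfolding pred_def by (metis (no_types, lifting) mem_Collect_eq subsetI)
qed

lemma measurable_connected_to [measurable]: "Measurable.pred (env_law \<mu>) (\<lambda>\<G>. connected_to \<G> x y)"
proof -
  have [measurable]: "Measurable.pred (env_law \<mu>) (\<lambda>\<G>. reach_in \<G> x n y)" for n y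
    by (induction n arbitrary: y) simp_all
  show ?thesis unfolding connected_to_iff_reach_in by measurable
qed

lemma measurable_adv [measurable]: "Measurable.pred (env_law \<mu>) (\<lambda>\<G>. (adv \<alpha> \<beta> \<G> ^^ n) u = w)"
proof (induction n arbitrary: w)
  case (Suc n)
  \<comment> \<open>Quantifying over the current position \<open>z\<close> ensures that the
    environment is read only at a site that does not itself depend on it.\<close>
  have "(adv \<alpha> \<beta> \<G> ^^ Suc n) u = w \<longleftrightarrow> (\<exists>z. (adv \<alpha> \<beta> \<G> ^^ n) u = z \<and>
     (\<alpha> \<in> \<G> z \<and> w = z + \<alpha> \<or> \<alpha> \<notin> \<G> z \<and> w = z + \<beta>))" for \<G>
    unfolding funpow.simps comp_apply adv_def[of \<alpha> \<beta> \<G> "(adv \<alpha> \<beta> \<G> ^^ n) u"] by auto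
  note [measurable] = Suc
  show ?case unfolding \<open>\<And>\<G>. (adv \<alpha> \<beta> \<G> ^^ Suc n) u = w \<longleftrightarrow> _\<close> by measurable
qed simp

lemma measurable_coalesces [measurable]: "Measurable.pred (env_law \<mu>) (\<lambda>\<G>. coalesces \<alpha> \<beta> \<G> u v)"
proof -
  have "coalesces \<alpha> \<beta> \<G> u v \<longleftrightarrow> (\<exists>n w. (adv \<alpha> \<beta> \<G> ^^ n) u = w \<and> (adv \<beta> \<alpha> \<G> ^^ n) v = w)" for \<G>
    unfolding coalesces_def by metis
  then show ?thesis unfolding \<open>\<And>\<G>. coalesces \<alpha> \<beta> \<G> u v \<longleftrightarrow> _\<close> by measurable
qed

lemma measurable_filled [measurable]: "Measurable.pred (env_law \<mu>) (\<lambda>\<G>. z \<in> filled_cluster \<G> x)"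
  unfolding mem_filled_cluster_iff by measurable

lemma measurable_fills [measurable]:
  "Measurable.pred (env_law \<mu>) (\<lambda>\<G>. fills_plane \<G> x)"
  "Measurable.pred (env_law \<mu>) (\<lambda>\<G>. fills_above \<G> x)"
  "Measurable.pred (env_law \<mu>) (\<lambda>\<G>. fills_below \<G> x)"
proof -
  have "fills_plane \<G> x \<longleftrightarrow> (\<forall>z. z \<in> filled_cluster \<G> x)" for \<G>
    by (auto simp: fills_plane_def)
  then show "Measurable.pred (env_law \<mu>) (\<lambda>\<G>. fills_plane \<G> x)" by simp
  show "Measurable.pred (env_law \<mu>) (\<lambda>\<G>. fills_above \<G> x)" unfolding fills_above_iff by measurable
  show "Measurable.pred (env_law \<mu>) (\<lambda>\<G>. fills_below \<G> x)" unfolding fills_below_iff by measurable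
qed

lemma measurable_gaps [measurable]:
  "Measurable.pred (env_law \<mu>) (\<lambda>\<G>. z \<in> low_gap \<G> x)"
  "Measurable.pred (env_law \<mu>) (\<lambda>\<G>. z \<in> up_gap \<G> x)"
  "Measurable.pred (env_law \<mu>) (\<lambda>\<G>. low_gap \<G> x = {})"
  "Measurable.pred (env_law \<mu>) (\<lambda>\<G>. up_gap \<G> x = {})"
proof -
  have eq: "z \<in> low_gap \<G> x \<longleftrightarrow> (\<forall>y. connected_to \<G> x y \<longrightarrow> \<not> y \<le> z)"
    "z \<in> up_gap \<G> x \<longleftrightarrow> (\<forall>y. connected_to \<G> x y \<longrightarrow> \<not> z \<le> y)" for \<G> z
    by (auto simp: low_gap_def up_gap_def cluster_def)
  show [measurable]: "Measurable.pred (env_law \<mu>) (\<lambda>\<G>. z \<in> low_gap \<G> x)"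
    "Measurable.pred (env_law \<mu>) (\<lambda>\<G>. z \<in> up_gap \<G> x)" for z
    unfolding eq by measurable
  have "A = {} \<longleftrightarrow> (\<forall>z::site. z \<notin> A)" for A by auto
  note eq' = this[of "low_gap _ x"] this[of "up_gap _ x"]
  show "Measurable.pred (env_law \<mu>) (\<lambda>\<G>. low_gap \<G> x = {})"
    "Measurable.pred (env_law \<mu>) (\<lambda>\<G>. up_gap \<G> x = {})"
    unfolding eq' by measurable
qed

section \<open>Independence of sites\<close>


definition cylinder :: "site set \<Rightarrow> (site \<Rightarrow> site set set) \<Rightarrow> (site \<Rightarrow> site set) set" where
  "cylinder J T = {\<G> \<in> space (env_law \<mu>). \<forall>j\<in>J. \<G> j \<in> T j}"

text \<open>A pointwise substitute for depending only on the sites outside \<open>J\<close>: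
  changing the environment at a site of \<open>J\<close> does not affect membership.\<close>

definition ignores :: "site set \<Rightarrow> (site \<Rightarrow> site set) set \<Rightarrow> bool" where
  "ignores J A \<longleftrightarrow> (\<forall>\<G>\<in>space (env_law \<mu>). \<forall>j\<in>J. \<forall>S\<subseteq>unit_steps. \<G>(j := S) \<in> A \<longleftrightarrow> \<G> \<in> A)"

lemma cylinder_sets:
  assumes "\<And>j. j \<in> J \<Longrightarrow> T j \<subseteq> Pow unit_steps"
  shows "cylinder J T \<in> sets (env_law \<mu>)"
proof -
  have "cylinder J T = {\<G> \<in> space (env_law \<mu>). \<forall>j. j \<in> J \<longrightarrow> \<G> j \<in> T j}"
    by (auto simp: cylinder_def)
  moreover have "{\<G> \<in> space (env_law \<mu>). j \<in> J \<longrightarrow> \<G> j \<in> T j} \<in> sets (env_law \<mu>)" for j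
    using measurable_site_set[OF assms, of j j] by (cases "j \<in> J") auto
  ultimately show ?thesis by (auto intro: sets.sets_Collect_countable_All)
qed

text \<open>Resampling one site leaves the law invariant, so an event which ignores that site is
  independent of it.\<close>

lemma prob_site_indep:
  assumes A: "A \<in> sets (env_law \<mu>)" "ignores {z} A" and T: "T \<subseteq> Pow unit_steps"
  shows "prob (cylinder {z} (\<lambda>_. T) \<inter> A) = measure \<mu> T * prob A"
proof -
  let ?f = "\<lambda>(S, \<G>). (\<G> :: site \<Rightarrow> site set)(z := S)"
  let ?P = "\<mu> \<Otimes>\<^sub>M env_law \<mu>"
  have eq: "distr ?P (env_law \<mu>) ?f = env_law \<mu>"
    using distr_pair_PiM_eq_PiM[of UNIV "\<lambda>_. \<mu>" z] \<mu>.prob_space_axioms by (simp add: env_law_def)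
  have "(\<lambda>(\<G>, S). (\<G> :: site \<Rightarrow> site set)(z := S)) \<in> measurable (env_law \<mu> \<Otimes>\<^sub>M \<mu>) (env_law \<mu>)"
    using measurable_add_dim[of z UNIV "\<lambda>_. \<mu>"] by (simp add: env_law_def)
  from measurable_compose[OF measurable_pair_swap' this]
  have f: "?f \<in> measurable ?P (env_law \<mu>)" by (simp add: case_prod_beta')
  have B: "cylinder {z} (\<lambda>_. T) \<inter> A \<in> sets (env_law \<mu>)" using A T cylinder_sets by auto
  have "?f -` (cylinder {z} (\<lambda>_. T) \<inter> A) \<inter> space ?P = T \<times> A"
  proof (intro set_eqI)
    fix w show "w \<in> ?f -` (cylinder {z} (\<lambda>_. T) \<inter> A) \<inter> space ?P \<longleftrightarrow> w \<in> T \<times> A"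
    proof (cases w)
      case (Pair S \<G>)
      have "\<G> \<in> A \<Longrightarrow> \<G> \<in> space (env_law \<mu>)" using A(1) sets.sets_into_space by blast
      moreover have "\<G> \<in> space (env_law \<mu>) \<Longrightarrow> S \<subseteq> unit_steps \<Longrightarrow> \<G>(z := S) \<in> A \<longleftrightarrow> \<G> \<in> A"
        using A(2) unfolding ignores_def by blast
      ultimately show ?thesis
        using T unfolding Pair cylinder_def by (auto simp: space_pair_measure space_mu space_env)
    qed
  qed
  then have "prob (cylinder {z} (\<lambda>_. T) \<inter> A) = measure ?P (T \<times> A)"
    using measure_distr[OF f B] by (simp add: eq)
  also have "\<dots> = measure \<mu> T * prob A"
    using A(1) T emeasure_pair_measure_Times[of T \<mu> A]
    by (simp add: sets_mu measure_def enn2real_mult)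
  finally show ?thesis .
qed

lemma prob_sites_indep:
  assumes "finite J" "A \<in> sets (env_law \<mu>)" "ignores J A" "\<And>j. j \<in> J \<Longrightarrow> T j \<subseteq> Pow unit_steps"
  shows "prob (cylinder J T \<inter> A) = (\<Prod>j\<in>J. measure \<mu> (T j)) * prob A"
  using assms
proof (induction J)
  case empty
  then have "cylinder {} T \<inter> A = A" using sets.sets_into_space by (auto simp: cylinder_def)
  then show ?case by simp
next
  case (insert z J)
  have B: "cylinder J T \<inter> A \<in> sets (env_law \<mu>)"
    using insert.prems cylinder_sets[of J T] by auto
  have ig: "ignores {z} (cylinder J T \<inter> A)"
    using insert.prems(2) insert.hyps(2) unfolding ignores_def cylinder_def by (auto simp: space_env)
  have "cylinder (insert z J) T \<inter> A = cylinder {z} (\<lambda>_. T z) \<inter> (cylinder J T \<inter> A)"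
    by (auto simp: cylinder_def)
  then have "prob (cylinder (insert z J) T \<inter> A) = measure \<mu> (T z) * prob (cylinder J T \<inter> A)"
    using prob_site_indep[OF B ig] insert.prems(3) by simp
  also have "prob (cylinder J T \<inter> A) = (\<Prod>j\<in>J. measure \<mu> (T j)) * prob A"
    using insert by (auto simp: ignores_def)
  finally show ?case using insert.hyps by simp
qed

lemma prob_cylinder:
  assumes "finite J" "\<And>j. j \<in> J \<Longrightarrow> T j \<subseteq> Pow unit_steps"
  shows "prob (cylinder J T) = (\<Prod>j\<in>J. measure \<mu> (T j))"
proof -
  have "ignores J (space (env_law \<mu>))" by (auto simp: ignores_def space_env)
  moreover have "cylinder J T \<inter> space (env_law \<mu>) = cylinder J T" by (auto simp: cylinder_def)
  ultimately show ?thesis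
    using prob_sites_indep[OF assms(1), of "space (env_law \<mu>)" T] assms(2) prob_space by simp
qed

lemma meets_subset: "meets E \<subseteq> Pow unit_steps"
  by (auto simp: meets_def)

lemma AE_site:
  assumes "measure \<mu> (meets E) = 1"
  shows "AE \<G> in env_law \<mu>. \<G> z \<inter> E \<noteq> {}"
proof -
  have "prob (cylinder {z} (\<lambda>_. meets E)) = 1"
    using prob_cylinder[of "{z}" "\<lambda>_. meets E"] meets_subset assms by simp
  from prob_eq_1[THEN iffD1, OF _ this] show ?thesis
    using cylinder_sets[of "{z}" "\<lambda>_. meets E"] meets_subset
    by (auto simp: cylinder_def meets_def elim!: AE_mp intro!: AE_I2)
qed

text \<open>If all sites of \<open>Z\<close> lack \<open>s\<close>, so do any \<open>n\<close>
  chosen ones, which has probability \<open>(1 - p) ^ n\<close>.\<close>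

lemma AE_infinite_sites:
  assumes "infinite Z" "measure \<mu> (meets {s}) > 0"
  shows "AE \<G> in env_law \<mu>. \<exists>z\<in>Z. s \<in> \<G> z"
proof -
  define p where "p = measure \<mu> (meets {s})"
  let ?T = "\<lambda>_. Pow unit_steps - meets {s}"
  have q: "measure \<mu> (?T ()) = 1 - p"
    using \<mu>.prob_compl[of "meets {s}"] by (simp add: p_def sets_mu meets_subset space_mu)
  have cyl: "cylinder J ?T \<in> sets (env_law \<mu>)" for J
    by (rule cylinder_sets) auto
  have "prob (cylinder Z ?T) \<le> (1 - p) ^ n" for n
  proof -
    obtain J where J: "J \<subseteq> Z" "finite J" "card J = n"
      using infinite_arbitrarily_large[OF assms(1)] by blast
    have "prob (cylinder Z ?T) \<le> prob (cylinder J ?T)"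
      using J cyl by (intro finite_measure_mono) (auto simp: cylinder_def)
    also have "\<dots> = (1 - p) ^ n" using prob_cylinder[OF J(2), of ?T] J q by simp
    finally show ?thesis .
  qed
  moreover have "(\<lambda>n. (1 - p) ^ n) \<longlonglongrightarrow> 0"
    using assms(2) \<mu>.prob_le_1[of "meets {s}"] by (intro LIMSEQ_realpow_zero) (auto simp: p_def)
  ultimately have "prob (cylinder Z ?T) \<le> 0"
    by (meson LIMSEQ_le_const)
  then have "prob (cylinder Z ?T) = 0" using measure_nonneg[of "env_law \<mu>"] by (simp add: order_antisym)
  from prob_eq_0[THEN iffD1, OF _ this] cyl
  have "AE \<G> in env_law \<mu>. \<G> \<notin> cylinder Z ?T" by blast
  then show ?thesis
    by (rule AE_mp) (rule AE_I2, unfold cylinder_def meets_def space_env, blast)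
qed

end

section \<open>Zero-one law\<close>

definition shift_env :: "site \<Rightarrow> (site \<Rightarrow> site set) \<Rightarrow> site \<Rightarrow> site set" where
  "shift_env d \<G> z = \<G> (z + d)"

lemma cluster_shift_subset: "y \<in> cluster \<G> (x + d) \<Longrightarrow> y - d \<in> cluster (shift_env d \<G>) x"
proof -
  have "cluster \<G> (x + d) \<subseteq> {y. y - d \<in> cluster (shift_env d \<G>) x}"
  proof (rule cluster_subset)
    fix y s assume y: "y \<in> {y. y - d \<in> cluster (shift_env d \<G>) x}" "s \<in> \<G> y"
    then have "s \<in> shift_env d \<G> (y - d)" by (simp add: shift_env_def)
    from cluster_step[of s "shift_env d \<G>" "y - d" x] this y(1) show "y + s \<in> {y. y - d \<in> cluster (shift_env d \<G>) x}"
      by (simp add: algebra_simps)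
  qed simp
  then show "y \<in> cluster \<G> (x + d) \<Longrightarrow> y - d \<in> cluster (shift_env d \<G>) x" by blast
qed

lemma cluster_shift: "y \<in> cluster (shift_env d \<G>) x \<longleftrightarrow> y + d \<in> cluster \<G> (x + d)"
proof
  assume "y \<in> cluster (shift_env d \<G>) x"
  moreover have "shift_env (- d) (shift_env d \<G>) = \<G>" by (auto simp: shift_env_def)
  ultimately show "y + d \<in> cluster \<G> (x + d)"
    using cluster_shift_subset[of y "shift_env d \<G>" "x + d" "- d"] by simp
next
  assume "y + d \<in> cluster \<G> (x + d)"
  from cluster_shift_subset[OF this] show "y \<in> cluster (shift_env d \<G>) x" by simp
qed

lemma gap_shift:
  "z \<in> low_gap (shift_env d \<G>) x \<longleftrightarrow> z + d \<in> low_gap \<G> (x + d)"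
  "z \<in> up_gap (shift_env d \<G>) x \<longleftrightarrow> z + d \<in> up_gap \<G> (x + d)"
proof -
  have all: "(\<forall>y. P y) \<longleftrightarrow> (\<forall>y. P (y + d))" for P :: "site \<Rightarrow> bool"
    by (metis diff_add_cancel)
  show "z \<in> low_gap (shift_env d \<G>) x \<longleftrightarrow> z + d \<in> low_gap \<G> (x + d)"
    unfolding low_gap_def Ball_def mem_Collect_eq cluster_shift
    by (subst (2) all) (simp add: site_le_iff)
  show "z \<in> up_gap (shift_env d \<G>) x \<longleftrightarrow> z + d \<in> up_gap \<G> (x + d)"
    unfolding up_gap_def Ball_def mem_Collect_eq cluster_shift
    by (subst (2) all) (simp add: site_le_iff)
qed

lemma gap_shift_empty:
  "low_gap (shift_env d \<G>) x = {} \<longleftrightarrow> low_gap \<G> (x + d) = {}"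
  "up_gap (shift_env d \<G>) x = {} \<longleftrightarrow> up_gap \<G> (x + d) = {}"
proof -
  have e: "A = {} \<longleftrightarrow> (\<forall>z. z + d \<notin> A)" for A :: "site set"
    by (metis diff_add_cancel equals0D equals0I)
  show "low_gap (shift_env d \<G>) x = {} \<longleftrightarrow> low_gap \<G> (x + d) = {}"
    "up_gap (shift_env d \<G>) x = {} \<longleftrightarrow> up_gap \<G> (x + d) = {}"
    unfolding e[of "low_gap \<G> (x + d)"] e[of "up_gap \<G> (x + d)"] gap_shift[symmetric] by auto
qed

context step_law
begin

lemma distr_shift: "distr (env_law \<mu>) (env_law \<mu>) (shift_env d) = env_law \<mu>"
proof -
  have "restrict (\<lambda>n. \<omega> (n + d)) UNIV = shift_env d \<omega>" for \<omega>
    by (rule ext) (simp add: shift_env_def)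
  then show ?thesis
    using distr_PiM_reindex[of UNIV "\<lambda>_. \<mu>" "\<lambda>z. z + d" UNIV] \<mu>.prob_space_axioms
    by (simp add: env_law_def inj_on_def)
qed

lemma measurable_shift: "shift_env d \<in> measurable (env_law \<mu>) (env_law \<mu>)"
  unfolding shift_env_def[abs_def] env_law_def by (intro measurable_PiM_single') (auto simp: space_PiM)

lemma shift_env_space: "\<G> \<in> space (env_law \<mu>) \<Longrightarrow> shift_env d \<G> \<in> space (env_law \<mu>)"
  unfolding space_env shift_env_def by blast

lemma prob_shift:
  assumes "Measurable.pred (env_law \<mu>) P"
  shows "prob {\<G> \<in> space (env_law \<mu>). P (shift_env d \<G>)} = prob {\<G> \<in> space (env_law \<mu>). P \<G>}"
proof -
  have "{\<G> \<in> space (env_law \<mu>). P \<G>} \<in> sets (env_law \<mu>)" using assms by simp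
  from measure_distr[OF measurable_shift this, of d]
  have "prob {\<G> \<in> space (env_law \<mu>). P \<G>} =
      prob (shift_env d -` {\<G> \<in> space (env_law \<mu>). P \<G>} \<inter> space (env_law \<mu>))"
    by (simp add: distr_shift)
  also have "shift_env d -` {\<G> \<in> space (env_law \<mu>). P \<G>} \<inter> space (env_law \<mu>)
      = {\<G> \<in> space (env_law \<mu>). P (shift_env d \<G>)}"
    using shift_env_space[of _ d] by auto
  finally show ?thesis ..
qed

section \<open>Mixing of the horizontal shift\<close>

lemma space_env_PiE: "space (env_law \<mu>) = (\<Pi>\<^sub>E j\<in>UNIV. space \<mu>)"
  by (simp add: env_law_def space_PiM)

lemma prod_algebra_cylinder:
  assumes "A \<in> prod_algebra UNIV (\<lambda>_::site. \<mu>)"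
  obtains J T where "finite J" "\<And>j. T j \<subseteq> Pow unit_steps" "A = cylinder J T"
proof -
  obtain J E where A: "A = prod_emb UNIV (\<lambda>_. \<mu>) J (\<Pi>\<^sub>E j\<in>J. E j)" "finite J"
    "\<And>j. j \<in> J \<Longrightarrow> E j \<in> sets \<mu>"
    using prod_algebraE[OF assms] by metis
  have "A = cylinder J (\<lambda>j. E j \<inter> Pow unit_steps)"
    unfolding A(1) cylinder_def space_env_PiE
    by (auto simp: prod_emb_def PiE_iff space_mu)
  then show thesis using that[of J "\<lambda>j. E j \<inter> Pow unit_steps"] A(2) by blast
qed

text \<open>Dynkin's pi-lambda theorem, with the cylinders over finitely many sites as
  generator.\<close>

lemma env_events_induct [consumes 1, case_names cylinder compl union]:
  assumes "A \<in> sets (env_law \<mu>)"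
    and "\<And>J T. finite J \<Longrightarrow> (\<And>j. T j \<subseteq> Pow unit_steps) \<Longrightarrow> P (cylinder J T)"
    and "\<And>A. A \<in> sets (env_law \<mu>) \<Longrightarrow> P A \<Longrightarrow> P (space (env_law \<mu>) - A)"
    and "\<And>A. disjoint_family A \<Longrightarrow> range A \<subseteq> sets (env_law \<mu>) \<Longrightarrow> (\<And>i. P (A i)) \<Longrightarrow> P (\<Union>i::nat. A i)"
  shows "P A"
proof -
  have s: "sets (env_law \<mu>) = sigma_sets (space (env_law \<mu>)) (prod_algebra UNIV (\<lambda>_. \<mu>))"
    unfolding space_env_PiE by (simp add: env_law_def sets_PiM)
  have "prod_algebra UNIV (\<lambda>_::site. \<mu>) \<subseteq> Pow (space (env_law \<mu>))"
    using prod_algebra_sets_into_space[of UNIV "\<lambda>_::site. \<mu>"] unfolding space_env_PiE by simp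
  from Int_stable_prod_algebra this assms(1)[unfolded s] show ?thesis
  proof (induction rule: sigma_sets_induct_disjoint)
    case (basic A)
    then show ?case using prod_algebra_cylinder assms(2) by metis
  next
    case empty
    \<comment> \<open>The empty event is a cylinder too: one arbitrary site is required to take an
      impossible value.\<close>
    have "cylinder {undefined} (\<lambda>_. {}) = {}" by (auto simp: cylinder_def)
    then show ?case using assms(2)[of "{undefined}" "\<lambda>_. {}"] by simp
  next
    case (compl A)
    then show ?case using assms(3) s by simp
  next
    case (union A)
    then show ?case using assms(4) s by simp
  qed
qed

lemma cylinder_shift:
  "{\<G> \<in> space (env_law \<mu>). shift_env d \<G> \<in> cylinder J T} = cylinder ((\<lambda>j. j + d) ` J) (\<lambda>j. T (j - d))"
proof (rule set_eqI)
  fix \<G>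
  show "\<G> \<in> {\<G> \<in> space (env_law \<mu>). shift_env d \<G> \<in> cylinder J T} \<longleftrightarrow>
      \<G> \<in> cylinder ((\<lambda>j. j + d) ` J) (\<lambda>j. T (j - d))"
    unfolding cylinder_def using shift_env_space[of \<G> d] by (auto simp: shift_env_def[of d \<G>])
qed

lemma ignores_cylinder:
  assumes "K \<inter> J = {}"
  shows "ignores K (cylinder J T)"
  unfolding ignores_def
proof (intro ballI allI impI)
  fix \<G> k S assume "\<G> \<in> space (env_law \<mu>)" "k \<in> K" "S \<subseteq> unit_steps"
  then have "\<G>(k := S) \<in> space (env_law \<mu>)" unfolding space_env by simp
  moreover have "(\<forall>j\<in>J. (\<G>(k := S)) j \<in> T j) \<longleftrightarrow> (\<forall>j\<in>J. \<G> j \<in> T j)"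
    using \<open>k \<in> K\<close> assms by (intro ball_cong) auto
  ultimately show "\<G>(k := S) \<in> cylinder J T \<longleftrightarrow> \<G> \<in> cylinder J T"
    using \<open>\<G> \<in> _\<close> by (simp add: cylinder_def)
qed

text \<open>For a cylinder in place of \<open>A\<close>, the product formula is exact once the shift
  has separated the two finite sets of sites. Complements and disjoint unions preserve the
  limit.\<close>

lemma mixing_cylinder:
  assumes J: "finite J" and T: "\<And>j. T j \<subseteq> Pow unit_steps" and A: "A \<in> sets (env_law \<mu>)"
  defines "C \<equiv> \<lambda>n. {\<G> \<in> space (env_law \<mu>). shift_env (int n, 0) \<G> \<in> cylinder J T}"
  shows "(\<lambda>n. prob (A \<inter> C n)) \<longlonglongrightarrow> prob A * prob (cylinder J T)"
  using A
proof (induction rule: env_events_induct)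
  have Cs: "C n \<in> sets (env_law \<mu>)" for n
    unfolding C_def cylinder_shift by (intro cylinder_sets T)
  have Cp: "prob (C n) = prob (cylinder J T)" for n
  proof -
    have "Measurable.pred (env_law \<mu>) (\<lambda>\<G>. \<G> \<in> cylinder J T)"
      using cylinder_sets[of J T] T by simp
    from prob_shift[OF this, of "(int n, 0)"]
    have "prob (C n) = prob {\<G> \<in> space (env_law \<mu>). \<G> \<in> cylinder J T}"
      unfolding C_def .
    also have "{\<G> \<in> space (env_law \<mu>). \<G> \<in> cylinder J T} = cylinder J T"
      by (auto simp: cylinder_def)
    finally show ?thesis .
  qed
  {
    case (cylinder K U)
    \<comment> \<open>The largest horizontal offset from a site of \<open>J\<close> to a site of
      \<open>K\<close>; a longer shift carries \<open>J\<close> off \<open>K\<close>.\<close>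
    define N where "N = Max (insert 0 ((\<lambda>(k, j). nat (fst k - fst j)) ` (K \<times> J)))"
    have "prob (cylinder K U \<inter> C n) = prob (cylinder K U) * prob (cylinder J T)" if "n > N" for n
    proof -
      have "k \<noteq> j + (int n, 0)" if "k \<in> K" "j \<in> J" for k j
      proof
        assume "k = j + (int n, 0)"
        then have "n = nat (fst k - fst j)" by simp
        then have "n \<le> N" unfolding N_def using that J cylinder(1)
          by (intro Max_ge) (auto intro!: image_eqI[of _ _ "(k, j)"])
        with \<open>n > N\<close> show False by simp
      qed
      then have "ignores K (C n)"
        unfolding C_def cylinder_shift by (intro ignores_cylinder) blast
      from prob_sites_indep[OF cylinder(1) Cs this] prob_cylinder[OF cylinder(1)] cylinder(2) Cp
      show ?thesis by simp
    qed
    then have "eventually (\<lambda>n. prob (cylinder K U \<inter> C n) = prob (cylinder K U) * prob (cylinder J T)) sequentially"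
      by (intro eventually_sequentiallyI[of "Suc N"]) simp
    then show ?case by (rule tendsto_eventually)
  next
    case (compl A)
    have eq: "prob ((space (env_law \<mu>) - A) \<inter> C n) = prob (cylinder J T) - prob (A \<inter> C n)" for n
    proof -
      have "(space (env_law \<mu>) - A) \<inter> C n = C n - A \<inter> C n" by (auto simp: C_def)
      then show ?thesis using finite_measure_Diff[of "C n" "A \<inter> C n"] Cs compl(1) Cp by auto
    qed
    have "(\<lambda>n. prob (cylinder J T) - prob (A \<inter> C n)) \<longlonglongrightarrow>
        prob (cylinder J T) - prob A * prob (cylinder J T)"
      by (intro tendsto_intros compl)
    then show ?case
      unfolding eq using prob_compl[OF compl(1)] by (simp add: left_diff_distrib)
  next
    case (union A)
    have sums: "(\<lambda>i. prob (A i)) sums prob (\<Union>i. A i)"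
      using union by (intro finite_measure_UNION) auto
    have sumsC: "(\<lambda>i. prob (A i \<inter> C n)) sums prob ((\<Union>i. A i) \<inter> C n)" for n
    proof -
      have "(\<lambda>i. prob (A i \<inter> C n)) sums prob (\<Union>i. A i \<inter> C n)"
        using union Cs by (intro finite_measure_UNION) (auto simp: disjoint_family_on_def)
      then show ?thesis by simp
    qed
    \<comment> \<open>Dominated convergence for series: the terms are bounded by
      \<open>prob (A i)\<close>, which is summable because the events are disjoint.\<close>
    have "(\<lambda>n. suminf (\<lambda>i. prob (A i \<inter> C n))) \<longlonglongrightarrow> suminf (\<lambda>i. prob (A i) * prob (cylinder J T))"
    proof (rule tannerys_theorem[where M = "\<lambda>i. prob (A i)", THEN conjunct2, THEN conjunct2])
      show "\<forall>\<^sub>F (i, n) in at_top \<times>\<^sub>F sequentially. norm (prob (A i \<inter> C n)) \<le> prob (A i)"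
        using union by (intro always_eventually) (auto intro!: finite_measure_mono)
    qed (use union(3) sums in \<open>auto simp: sums_iff\<close>)
    moreover have "suminf (\<lambda>i. prob (A i) * prob (cylinder J T)) = prob (\<Union>i. A i) * prob (cylinder J T)"
      using sums_mult2[OF sums] by (simp add: sums_iff)
    ultimately show ?case using sumsC by (simp add: sums_iff)
  }
qed

text \<open>By invariance the sequence in \<open>mixing_cylinder\<close> is constant, so the event
  is independent of every cylinder, then of every event, and finally of itself.\<close>

lemma shift_invariant_zero_one:
  assumes P: "Measurable.pred (env_law \<mu>) P"
    and inv: "\<And>n. AE \<G> in env_law \<mu>. P (shift_env (int n, 0) \<G>) \<longleftrightarrow> P \<G>"
  defines "A \<equiv> {\<G> \<in> space (env_law \<mu>). P \<G>}"
  shows "prob A = 0 \<or> prob A = 1"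
proof -
  have A: "A \<in> sets (env_law \<mu>)" using P by (simp add: A_def)
  have cyl: "prob (A \<inter> cylinder J T) = prob A * prob (cylinder J T)"
    if J: "finite J" and T: "\<And>j. T j \<subseteq> Pow unit_steps" for J T
  proof -
    have C: "cylinder J T \<in> sets (env_law \<mu>)" using cylinder_sets T by blast
    have "prob (A \<inter> {\<G> \<in> space (env_law \<mu>). shift_env (int n, 0) \<G> \<in> cylinder J T}) = prob (A \<inter> cylinder J T)" for n
    proof -
      have C': "{\<G> \<in> space (env_law \<mu>). shift_env (int n, 0) \<G> \<in> cylinder J T} \<in> sets (env_law \<mu>)"
        unfolding cylinder_shift by (intro cylinder_sets T)
      have AC: "{\<G> \<in> space (env_law \<mu>). P \<G> \<and> \<G> \<in> cylinder J T} = A \<inter> cylinder J T"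
        by (auto simp: A_def cylinder_def)
      have pr: "Measurable.pred (env_law \<mu>) (\<lambda>\<G>. P \<G> \<and> \<G> \<in> cylinder J T)"
        using P C by measurable
      from prob_shift[OF pr, of "(int n, 0)"]
      have "prob {\<G> \<in> space (env_law \<mu>). P (shift_env (int n, 0) \<G>) \<and> shift_env (int n, 0) \<G> \<in> cylinder J T}
        = prob (A \<inter> cylinder J T)"
        unfolding AC .
      moreover have "{\<G> \<in> space (env_law \<mu>). P (shift_env (int n, 0) \<G>) \<and> shift_env (int n, 0) \<G> \<in> cylinder J T} \<in> sets (env_law \<mu>)"
        using measurable_compose[OF measurable_shift pr] by simp
      then have "prob {\<G> \<in> space (env_law \<mu>). P (shift_env (int n, 0) \<G>) \<and> shift_env (int n, 0) \<G> \<in> cylinder J T}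
        = prob (A \<inter> {\<G> \<in> space (env_law \<mu>). shift_env (int n, 0) \<G> \<in> cylinder J T})"
        using inv[of n] A C' by (intro finite_measure_eq_AE) (auto simp: A_def)
      ultimately show ?thesis by simp
    qed
    then have "(\<lambda>n::nat. prob (A \<inter> cylinder J T)) \<longlonglongrightarrow> prob A * prob (cylinder J T)"
      using mixing_cylinder[where T = T, OF J T A] by simp
    then show ?thesis by (rule LIMSEQ_unique[OF tendsto_const])
  qed
  have "prob (A \<inter> B) = prob A * prob B" if "B \<in> sets (env_law \<mu>)" for B
    using that
  proof (induction rule: env_events_induct)
    case (cylinder J T)
    then show ?case by (rule cyl)
  next
    case (compl B)
    have "A \<inter> (space (env_law \<mu>) - B) = A - A \<inter> B" by (auto simp: A_def)
    moreover have "prob (A - A \<inter> B) = prob A - prob A * prob B"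
      using finite_measure_Diff[of A "A \<inter> B"] A compl by auto
    ultimately show ?case using prob_compl[OF compl(1)] by (simp add: right_diff_distrib)
  next
    case (union B)
    have "(\<lambda>i. prob (B i)) sums prob (\<Union>i. B i)"
      using union by (intro finite_measure_UNION) auto
    from sums_mult[OF this, of "prob A"]
    have "(\<lambda>i. prob (A \<inter> B i)) sums (prob A * prob (\<Union>i. B i))" using union(3) by simp
    moreover have "(\<lambda>i. prob (A \<inter> B i)) sums prob (\<Union>i. A \<inter> B i)"
      using union A by (intro finite_measure_UNION) (auto simp: disjoint_family_on_def)
    ultimately show ?case by (simp add: sums_iff)
  qed
  from this[OF A] show ?thesis by simp
qed

end

section \<open>Coalescence\<close>

lemma coalesces_step:
  assumes "u \<noteq> v"
  shows "coalesces \<alpha> \<beta> \<G> u v \<longleftrightarrow> coalesces \<alpha> \<beta> \<G> (adv \<alpha> \<beta> \<G> u) (adv \<beta> \<alpha> \<G> v)"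
proof
  assume "coalesces \<alpha> \<beta> \<G> u v"
  then obtain n where n: "(adv \<alpha> \<beta> \<G> ^^ n) u = (adv \<beta> \<alpha> \<G> ^^ n) v" by (auto simp: coalesces_def)
  with assms obtain m where "n = Suc m" by (cases n) auto
  with n show "coalesces \<alpha> \<beta> \<G> (adv \<alpha> \<beta> \<G> u) (adv \<beta> \<alpha> \<G> v)"
    unfolding coalesces_def by (intro exI[of _ m]) (simp add: funpow_swap1)
next
  assume "coalesces \<alpha> \<beta> \<G> (adv \<alpha> \<beta> \<G> u) (adv \<beta> \<alpha> \<G> v)"
  then obtain n where "(adv \<alpha> \<beta> \<G> ^^ n) (adv \<alpha> \<beta> \<G> u) = (adv \<beta> \<alpha> \<G> ^^ n) (adv \<beta> \<alpha> \<G> v)"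
    by (auto simp: coalesces_def)
  then show "coalesces \<alpha> \<beta> \<G> u v"
    unfolding coalesces_def by (intro exI[of _ "Suc n"]) (simp add: funpow_swap1)
qed

text \<open>The recursion says \<open>a * d n \<le> b * d (Suc n)\<close> for the increments
  \<open>d\<close>. As \<open>a \<ge> b\<close>, increments no longer decrease after a positive one,
  and \<open>g\<close> would grow linearly against its bound. Hence \<open>g\<close> never rises
  above \<open>g 0 = 0\<close>.\<close>

lemma bounded_submartingale_zero:
  fixes g :: "nat \<Rightarrow> real"
  assumes g: "g 0 = 0" "\<And>n. 0 \<le> g n" "\<And>n. g n \<le> 1"
    and ab: "a \<ge> b" "a > 0" "b \<ge> 0"
    and rec: "\<And>n. (a + b) * g (Suc n) \<le> a * g n + b * g (Suc (Suc n))"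
  shows "g n = 0"
proof -
  define d where "d n = g (Suc n) - g n" for n
  have rec': "a * d n \<le> b * d (Suc n)" for n
    using rec[of n] by (simp add: d_def algebra_simps)
  have "d n \<le> 0" for n
  proof (rule ccontr)
    assume "\<not> d n \<le> 0"
    then have pos: "d n > 0" by simp
    have grow: "d n \<le> d (n + k)" for k
    proof (induction k)
      case (Suc k)
      then have dk: "d (n + k) > 0" using pos by linarith
      then have "0 < a * d (n + k)" using ab by simp
      then have "b * d (Suc (n + k)) > 0" using rec'[of "n + k"] by linarith
      then have "b > 0" using ab(3) by (metis less_eq_real_def mult_zero_left less_irrefl)
      have "b * d (n + k) \<le> a * d (n + k)" using ab dk by (intro mult_right_mono) auto
      then have "b * d (n + k) \<le> b * d (Suc (n + k))" using rec'[of "n + k"] by linarith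
      then have "d (n + k) \<le> d (Suc (n + k))" using \<open>b > 0\<close> by simp
      then show ?case using Suc by simp
    qed simp
    have "g (n + k) \<ge> g n + real k * d n" for k
    proof (induction k)
      case (Suc k)
      then show ?case using grow[of k] by (simp add: d_def algebra_simps)
    qed simp
    moreover obtain k where "real k * d n > 1" using pos reals_Archimedean3 by blast
    ultimately show False using g(2)[of n] g(3)[of "n + k"] by (smt (verit))
  qed
  then have "g (Suc n) \<le> g n" for n by (simp add: d_def)
  then have "g n \<le> g 0" using lift_Suc_antimono_le[of g 0 n] by blast
  then show ?thesis using g(1) g(2)[of n] by simp
qed

context step_law
begin

text \<open>The level \<open>lv\<close> rises by one at each step, so the sites read first are
  independent of each other and of all that follows. Conditioning on them bounds the failure
  probability at distance \<open>D\<close> by those at \<open>D - 1\<close>, \<open>D\<close> and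
  \<open>D + 1\<close>.\<close>

lemma AE_coalesces:
  fixes lv :: "site \<Rightarrow> int" and \<alpha> \<beta> u :: site
  assumes lv: "\<And>z w. lv (z + w) = lv z + lv w" "lv \<alpha> = 1" "lv \<beta> = 1"
    and diff: "\<beta> - \<alpha> = diag 1"
    and \<mu>: "measure \<mu> (meets {\<alpha>, \<beta>}) = 1" "measure \<mu> (meets {\<alpha>}) > 0" "measure \<mu> (meets {\<beta>}) > 0"
  shows "AE \<G> in env_law \<mu>. coalesces \<alpha> \<beta> \<G> (u + diag D) u"
proof -
  define p where "p = measure \<mu> (meets {\<alpha>})"
  define q where "q = measure \<mu> (meets {\<beta>})"
  define A where "A u v = {\<G> \<in> space (env_law \<mu>). \<not> coalesces \<alpha> \<beta> \<G> u v}" for u v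
  have A [measurable]: "A u v \<in> sets (env_law \<mu>)" for u v by (simp add: A_def)
  have pq: "0 < p" "p \<le> 1" "0 < q" "q \<le> 1"
    using \<mu> by (simp_all add: p_def q_def)
  have "meets {\<alpha>, \<beta>} = meets {\<alpha>} \<union> meets {\<beta>}" by (auto simp: meets_def)
  then have "1 \<le> p + q"
    using \<mu>(1) measure_Un_le[of "meets {\<alpha>}" \<mu> "meets {\<beta>}"] by (simp add: p_def q_def sets_mu meets_subset)
  have compl: "measure \<mu> (Pow unit_steps - meets {\<alpha>}) = 1 - p" "measure \<mu> (Pow unit_steps - meets {\<beta>}) = 1 - q"
    using \<mu>.prob_compl[of "meets {\<alpha>}"] \<mu>.prob_compl[of "meets {\<beta>}"]
    by (simp_all add: p_def q_def sets_mu meets_subset space_mu)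
  \<comment> \<open>A walk stays on levels at least that of its start, so altering a site on a lower
    level cannot influence it.\<close>
  have adv_upd: "(adv a b (\<G>(z := S)) ^^ n) w = (adv a b \<G> ^^ n) w \<and> lv ((adv a b \<G> ^^ n) w) = lv w + int n"
    if "lv z < lv w" "{a, b} = {\<alpha>, \<beta>}" for a b \<G> z S n w
  proof (induction n)
    case (Suc n)
    have ab: "lv a = 1" "lv b = 1" using that(2) lv by (auto simp: doubleton_eq_iff)
    define y where "y = (adv a b \<G> ^^ n) w"
    have y: "(adv a b (\<G>(z := S)) ^^ n) w = y" "lv y = lv w + int n" using Suc unfolding y_def by blast+
    then have "y \<noteq> z" using that(1) by auto
    then have "adv a b (\<G>(z := S)) y = adv a b \<G> y" by (simp add: adv_def)
    moreover have "(adv a b (\<G>(z := S)) ^^ Suc n) w = adv a b (\<G>(z := S)) y"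
      "(adv a b \<G> ^^ Suc n) w = adv a b \<G> y"
      by (simp_all only: funpow.simps comp_apply y(1)) (simp only: y_def)
    moreover have "lv (adv a b \<G> y) = lv w + int (Suc n)" using y(2) by (simp add: adv_def lv(1) ab)
    ultimately show ?case by metis
  qed simp
  have ig: "ignores {u, v} (A u' v')" if "lv u < lv u'" "lv u < lv v'" "lv v = lv u" for u v u' v'
    unfolding ignores_def
  proof (intro ballI allI impI)
    fix \<G> j S assume G: "\<G> \<in> space (env_law \<mu>)" "S \<subseteq> unit_steps" and j: "j \<in> {u, v}"
    have lt: "lv j < lv u'" "lv j < lv v'" using that j by auto
    have "(adv \<alpha> \<beta> (\<G>(j := S)) ^^ n) u' = (adv \<alpha> \<beta> \<G> ^^ n) u'"
      "(adv \<beta> \<alpha> (\<G>(j := S)) ^^ n) v' = (adv \<beta> \<alpha> \<G> ^^ n) v'" for n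
      using adv_upd[OF lt(1) refl] adv_upd[OF lt(2) insert_commute] by blast+
    then have "coalesces \<alpha> \<beta> (\<G>(j := S)) u' v' = coalesces \<alpha> \<beta> \<G> u' v'"
      unfolding coalesces_def by (simp only:)
    moreover have "\<G>(j := S) \<in> space (env_law \<mu>)" using G unfolding space_env by simp
    ultimately show "\<G>(j := S) \<in> A u' v' \<longleftrightarrow> \<G> \<in> A u' v'" using G by (simp add: A_def)
  qed
  have two: "prob {\<G> \<in> A u' v'. \<G> u \<in> S \<and> \<G> v \<in> T} = measure \<mu> S * measure \<mu> T * prob (A u' v')"
    if "u \<noteq> v" "lv v = lv u" "lv u' = lv u + 1" "lv v' = lv u + 1" "S \<subseteq> Pow unit_steps" "T \<subseteq> Pow unit_steps"
    for u v u' v' S T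
  proof -
    have "{\<G> \<in> A u' v'. \<G> u \<in> S \<and> \<G> v \<in> T} = cylinder {u, v} (\<lambda>j. if j = u then S else T) \<inter> A u' v'"
      using that(1) by (auto simp: A_def cylinder_def)
    then show ?thesis
      using prob_sites_indep[of "{u, v}" "A u' v'" "\<lambda>j. if j = u then S else T"] ig[of u u' v' v] that by simp
  qed
  \<comment> \<open>The supremum over starting points closes the recursion, because the pairs after
    one step start at other sites.\<close>
  define g where "g D = (SUP u. prob (A (u + diag D) u))" for D
  have bdd: "bdd_above (range (\<lambda>u. prob (A (u + diag D) u)))" for D
    by (rule bdd_aboveI[of _ 1]) auto
  have le_g: "prob (A w u) \<le> g D" if "w = u + diag D" for u w D
    unfolding g_def that by (rule cSUP_upper[OF _ bdd]) simp
  have "g D = 0" for D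
  proof (rule bounded_submartingale_zero[where g = g and a = "p * q" and b = "(1 - p) * (1 - q)"])
    have "coalesces \<alpha> \<beta> \<G> u u" for \<G> u unfolding coalesces_def by (intro exI[of _ 0]) simp
    then have "A (u + diag 0) u = {}" for u by (simp add: A_def diag_def zero_prod_def[symmetric])
    then show "g 0 = 0" by (simp add: g_def)
    show "0 \<le> g n" for n using le_g[OF refl, of undefined n] measure_nonneg order_trans by blast
    show "g n \<le> 1" for n unfolding g_def by (rule cSUP_least) auto
    show "(1 - p) * (1 - q) \<le> p * q" using \<open>1 \<le> p + q\<close> by (simp add: algebra_simps)
    show "0 < p * q" "0 \<le> (1 - p) * (1 - q)" using pq by auto
    show "(p * q + (1 - p) * (1 - q)) * g (Suc n) \<le> p * q * g n + (1 - p) * (1 - q) * g (Suc (Suc n))" for n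
    proof -
      have "prob (A (v + diag (Suc n)) v) \<le> p * q * g n + (1 - p) * (1 - q) * g (Suc (Suc n))
          + (p * (1 - q) + (1 - p) * q) * g (Suc n)" for v
      proof -
        define u where "u = v + diag (Suc n)"
        have \<beta>: "\<beta> = \<alpha> + diag 1" using diff by (simp add: algebra_simps)
        have "lv (diag 1) = 0" using lv \<beta> by (metis add_left_cancel add.right_neutral)
        have diag_Suc: "diag (Suc k) = diag k + diag 1" for k by (simp add: diag_def)
        have "lv (diag k) = 0" for k
        proof (induction k)
          case 0
          have "lv (diag 0 + diag 0) = lv (diag 0) + lv (diag 0)" by (rule lv)
          then show ?case by (simp add: diag_def)
        next
          case (Suc k)
          then show ?case using \<open>lv (diag 1) = 0\<close> unfolding diag_Suc[of k] lv(1) by simp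
        qed
        then have lvu: "lv v = lv u" by (simp add: u_def lv)
        have uv: "u \<noteq> v" by (simp add: u_def site_eq_iff)
        let ?S = "\<lambda>x. meets {x}" and ?N = "\<lambda>x. Pow unit_steps - meets {x}"
        \<comment> \<open>The four outcomes of the first step: \<open>?B1\<close> shortens the
          distance \<open>Suc n\<close> by one, \<open>?B2\<close> lengthens it by one,
          \<open>?B3\<close> and \<open>?B4\<close> keep it.\<close>
        let ?B1 = "{\<G> \<in> A (u + \<alpha>) (v + \<beta>). \<G> u \<in> ?S \<alpha> \<and> \<G> v \<in> ?S \<beta>}"
        let ?B2 = "{\<G> \<in> A (u + \<beta>) (v + \<alpha>). \<G> u \<in> ?N \<alpha> \<and> \<G> v \<in> ?N \<beta>}"
        let ?B3 = "{\<G> \<in> A (u + \<alpha>) (v + \<alpha>). \<G> u \<in> ?S \<alpha> \<and> \<G> v \<in> ?N \<beta>}"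
        let ?B4 = "{\<G> \<in> A (u + \<beta>) (v + \<beta>). \<G> u \<in> ?N \<alpha> \<and> \<G> v \<in> ?S \<beta>}"
        have sub: "A u v \<subseteq> (?B1 \<union> ?B2) \<union> (?B3 \<union> ?B4)"
        proof
          fix \<G> assume "\<G> \<in> A u v"
          then have G: "\<G> \<in> space (env_law \<mu>)" "\<G> \<in> A (adv \<alpha> \<beta> \<G> u) (adv \<beta> \<alpha> \<G> v)"
            using coalesces_step[OF uv] by (simp_all add: A_def)
          have "\<G> u \<subseteq> unit_steps" "\<G> v \<subseteq> unit_steps" using G(1) unfolding space_env by blast+
          then show "\<G> \<in> (?B1 \<union> ?B2) \<union> (?B3 \<union> ?B4)"
            using G(2) by (auto simp: adv_def meets_def split: if_splits)
        qed
        have Bsets: "?B1 \<in> sets (env_law \<mu>)" "?B2 \<in> sets (env_law \<mu>)" "?B3 \<in> sets (env_law \<mu>)" "?B4 \<in> sets (env_law \<mu>)"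
        proof -
          have "{\<G> \<in> A u' v'. \<G> u \<in> S \<and> \<G> v \<in> T} \<in> sets (env_law \<mu>)"
            if "S \<subseteq> Pow unit_steps" "T \<subseteq> Pow unit_steps" for u' v' S T
          proof -
            have "{\<G> \<in> A u' v'. \<G> u \<in> S \<and> \<G> v \<in> T} = cylinder {u, v} (\<lambda>j. if j = u then S else T) \<inter> A u' v'"
              using uv by (auto simp: A_def cylinder_def)
            then show ?thesis using cylinder_sets[of "{u, v}" "\<lambda>j. if j = u then S else T"] that A by auto
          qed
          note * = this
          show "?B1 \<in> sets (env_law \<mu>)" "?B2 \<in> sets (env_law \<mu>)" "?B3 \<in> sets (env_law \<mu>)" "?B4 \<in> sets (env_law \<mu>)"
            by (rule *; use meets_subset in blast)+
        qed
        have "prob (A u v) \<le> prob ((?B1 \<union> ?B2) \<union> (?B3 \<union> ?B4))"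
          using Bsets by (intro finite_measure_mono sub) auto
        also have "\<dots> \<le> prob (?B1 \<union> ?B2) + prob (?B3 \<union> ?B4)"
          using Bsets by (intro measure_Un_le) auto
        also have "\<dots> \<le> (prob ?B1 + prob ?B2) + (prob ?B3 + prob ?B4)"
          using Bsets by (intro add_mono measure_Un_le) auto
        also have "prob ?B1 = p * q * prob (A (u + \<alpha>) (v + \<beta>))"
          using two[OF uv lvu, of "u + \<alpha>" "v + \<beta>" "?S \<alpha>" "?S \<beta>"] lvu lv meets_subset by (simp add: p_def q_def)
        also have "prob ?B2 = (1 - p) * (1 - q) * prob (A (u + \<beta>) (v + \<alpha>))"
          using two[OF uv lvu, of "u + \<beta>" "v + \<alpha>" "?N \<alpha>" "?N \<beta>"] lvu lv compl by simp
        also have "prob ?B3 = p * (1 - q) * prob (A (u + \<alpha>) (v + \<alpha>))"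
          using two[OF uv lvu, of "u + \<alpha>" "v + \<alpha>" "?S \<alpha>" "?N \<beta>"] lvu lv compl meets_subset by (simp add: p_def)
        also have "prob ?B4 = (1 - p) * q * prob (A (u + \<beta>) (v + \<beta>))"
          using two[OF uv lvu, of "u + \<beta>" "v + \<beta>" "?N \<alpha>" "?S \<beta>"] lvu lv compl meets_subset by (simp add: q_def)
        finally have "prob (A u v) \<le> p * q * prob (A (u + \<alpha>) (v + \<beta>)) + (1 - p) * (1 - q) * prob (A (u + \<beta>) (v + \<alpha>))
          + (p * (1 - q) * prob (A (u + \<alpha>) (v + \<alpha>)) + (1 - p) * q * prob (A (u + \<beta>) (v + \<beta>)))" .
        also have "\<dots> \<le> p * q * g n + (1 - p) * (1 - q) * g (Suc (Suc n))
          + (p * (1 - q) * g (Suc n) + (1 - p) * q * g (Suc n))"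
          using pq by (intro add_mono mult_left_mono le_g) (auto simp: u_def \<beta> site_eq_iff)
        finally show ?thesis by (simp add: u_def algebra_simps)
      qed
      then have "g (Suc n) \<le> p * q * g n + (1 - p) * (1 - q) * g (Suc (Suc n))
          + (p * (1 - q) + (1 - p) * q) * g (Suc n)"
        unfolding g_def[of "Suc n"] by (intro cSUP_least) auto
      \<comment> \<open>The weights of the four outcomes add up to one, so moving the
        \<open>g (Suc n)\<close> term to the left leaves the factor
        \<open>p * q + (1 - p) * (1 - q)\<close>.\<close>
      then show ?thesis by (simp add: algebra_simps)
    qed
  qed
  then have "prob (A (u + diag D) u) = 0"
    using le_g[OF refl, of u D] measure_nonneg[of "env_law \<mu>" "A (u + diag D) u"] by simp
  then have "AE \<G> in env_law \<mu>. \<G> \<notin> A (u + diag D) u"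
    using prob_eq_0[OF A] by blast
  then show ?thesis by (rule AE_mp) (auto simp: A_def intro!: AE_I2)
qed

end

section \<open>The trichotomy\<close>

lemma up_gap_up: "z \<in> up_gap \<G> x \<Longrightarrow> z \<le> z' \<Longrightarrow> z' \<in> up_gap \<G> x"
  using order.trans[of z z'] by (auto simp: up_gap_def)

lemma low_gap_far_right:
  assumes "good_env \<G>" "low_gap \<G> x \<noteq> {}"
  shows "low_gap \<G> (x + (int n, 0)) \<noteq> {}"
proof (induction n)
  case 0
  then show ?case using assms(2) by (simp add: zero_prod_def[symmetric])
next
  case (Suc n)
  have eq: "x + (int (Suc n), 0) = x + (int n, 0) + e1" by (simp add: site_eq_iff)
  show ?case unfolding eq by (rule low_gap_shift[OF assms(1) Suc])
qed

lemma up_gap_far_right: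
  assumes "good_env \<G>" "up_gap \<G> (x + (int n, 0)) \<noteq> {}"
  shows "up_gap \<G> x \<noteq> {}"
  using assms(2)
proof (induction n)
  case 0
  then show ?case by (simp add: zero_prod_def[symmetric])
next
  case (Suc n)
  have eq: "x + (int n, 0) = x + (int (Suc n), 0) - e1" by (simp add: site_eq_iff)
  show ?case using up_gap_shift[OF assms(1) Suc(2)] unfolding eq[symmetric] by (rule Suc(1))
qed

context step_law
begin

lemma AE_good_env:
  assumes "measure \<mu> (meets {- e1, e2}) = 1" "measure \<mu> (meets {e1, - e2}) = 1"
    and "measure \<mu> (meets {- e1}) > 0" "measure \<mu> (meets {e1}) > 0"
    and "measure \<mu> (meets {e2}) > 0" "measure \<mu> (meets {- e2}) > 0"
  shows "AE \<G> in env_law \<mu>. good_env \<G>"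
proof -
  have nw: "AE \<G> in env_law \<mu>. coalesces (- e1) e2 \<G> (u + diag D) u" for u D
    by (rule AE_coalesces[where lv = "\<lambda>z. snd z - fst z"]) (use assms in \<open>simp_all add: site_eq_iff\<close>)
  have se: "AE \<G> in env_law \<mu>. coalesces (- e2) e1 \<G> (u + diag D) u" for u D
    by (rule AE_coalesces[where lv = "\<lambda>z. fst z - snd z"])
      (use assms in \<open>simp_all add: site_eq_iff insert_commute\<close>)
  have col: "AE \<G> in env_law \<mu>. (\<exists>t\<le>b. s \<in> \<G> (c, t)) \<and> (\<exists>t\<ge>b. s \<in> \<G> (c, t))"
    if "s \<in> {e1, - e1}" for b c :: int and s
  proof -
    have s: "measure \<mu> (meets {s}) > 0" using that assms by auto
    have "infinite (Pair c ` {..b})" "infinite (Pair c ` {b..})"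
      by (simp_all add: finite_image_iff inj_on_def infinite_Iic infinite_Ici)
    from AE_infinite_sites[OF this(1) s] AE_infinite_sites[OF this(2) s]
    show ?thesis by eventually_elim auto
  qed
  \<comment> \<open>Both values of \<open>s\<close> are written out, so that only quantifiers over
    countable types have to be exchanged with the almost sure quantifier.\<close>
  have "AE \<G> in env_law \<mu>. (\<forall>z. \<G> z \<inter> {- e1, e2} \<noteq> {} \<and> \<G> z \<inter> {e1, - e2} \<noteq> {}) \<and>
    (\<forall>c b. ((\<exists>t\<le>b. e1 \<in> \<G> (c, t)) \<and> (\<exists>t\<ge>b. e1 \<in> \<G> (c, t))) \<and>
      ((\<exists>t\<le>b. - e1 \<in> \<G> (c, t)) \<and> (\<exists>t\<ge>b. - e1 \<in> \<G> (c, t)))) \<and>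
    (\<forall>D u. coalesces (- e1) e2 \<G> (u + diag D) u \<and> coalesces (- e2) e1 \<G> (u + diag D) u)"
    using AE_site[OF assms(1)] AE_site[OF assms(2)] col nw se
    by (auto simp only: AE_conj_iff AE_all_countable insertI1 insertI2)
  with AE_space show ?thesis
  proof eventually_elim
    case (elim \<G>)
    have "\<G> z \<subseteq> unit_steps" for z using elim(1) unfolding space_env by blast
    with elim(2) show ?case unfolding good_env_def by (simp only: ball_simps) blast
  qed
qed

text \<open>Nested events of equal probability differ by a null set. Together with stationarity this
  upgrades the one-sided monotonicity of a gap under the shift to invariance.\<close>

lemma AE_iff_if_prob_eq:
  assumes [measurable]: "Measurable.pred (env_law \<mu>) P" "Measurable.pred (env_law \<mu>) Q"
    and imp: "AE \<G> in env_law \<mu>. P \<G> \<longrightarrow> Q \<G>"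
    and eq: "prob {\<G> \<in> space (env_law \<mu>). P \<G>} = prob {\<G> \<in> space (env_law \<mu>). Q \<G>}"
  shows "AE \<G> in env_law \<mu>. P \<G> \<longleftrightarrow> Q \<G>"
proof -
  have "prob {\<G> \<in> space (env_law \<mu>). Q \<G>} =
      prob ({\<G> \<in> space (env_law \<mu>). P \<G>} \<union> {\<G> \<in> space (env_law \<mu>). Q \<G> \<and> \<not> P \<G>})"
    using imp by (intro finite_measure_eq_AE) (auto elim!: AE_mp)
  also have "\<dots> = prob {\<G> \<in> space (env_law \<mu>). P \<G>} + prob {\<G> \<in> space (env_law \<mu>). Q \<G> \<and> \<not> P \<G>}"
    by (intro finite_measure_Union) auto
  finally have "prob {\<G> \<in> space (env_law \<mu>). Q \<G> \<and> \<not> P \<G>} = 0" using eq by simp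
  then have "AE \<G> in env_law \<mu>. \<not> (Q \<G> \<and> \<not> P \<G>)"
    by (subst (asm) prob_Collect_eq_0) auto
  with imp show ?thesis by eventually_elim blast
qed

lemma zero_one_low_gap:
  assumes good: "AE \<G> in env_law \<mu>. good_env \<G>"
  shows "prob {\<G> \<in> space (env_law \<mu>). low_gap \<G> x \<noteq> {}} \<in> {0, 1}"
proof -
  have P: "Measurable.pred (env_law \<mu>) (\<lambda>\<G>. low_gap \<G> x \<noteq> {})" by measurable
  have "AE \<G> in env_law \<mu>. low_gap \<G> x \<noteq> {} \<longleftrightarrow> low_gap (shift_env (int n, 0) \<G>) x \<noteq> {}" for n
  proof (rule AE_iff_if_prob_eq[OF P])
    show "Measurable.pred (env_law \<mu>) (\<lambda>\<G>. low_gap (shift_env (int n, 0) \<G>) x \<noteq> {})"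
      unfolding gap_shift_empty by measurable
    show "AE \<G> in env_law \<mu>. low_gap \<G> x \<noteq> {} \<longrightarrow> low_gap (shift_env (int n, 0) \<G>) x \<noteq> {}"
      using good unfolding gap_shift_empty by eventually_elim (use low_gap_far_right in blast)
  qed (rule prob_shift[OF P, symmetric])
  then show ?thesis
    using shift_invariant_zero_one[OF P] by fast
qed

lemma zero_one_up_gap:
  assumes good: "AE \<G> in env_law \<mu>. good_env \<G>"
  shows "prob {\<G> \<in> space (env_law \<mu>). up_gap \<G> x \<noteq> {}} \<in> {0, 1}"
proof -
  have P: "Measurable.pred (env_law \<mu>) (\<lambda>\<G>. up_gap \<G> x \<noteq> {})" by measurable
  have "AE \<G> in env_law \<mu>. up_gap (shift_env (int n, 0) \<G>) x \<noteq> {} \<longleftrightarrow> up_gap \<G> x \<noteq> {}" for n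
  proof (rule AE_iff_if_prob_eq[OF _ P])
    show "Measurable.pred (env_law \<mu>) (\<lambda>\<G>. up_gap (shift_env (int n, 0) \<G>) x \<noteq> {})"
      unfolding gap_shift_empty by measurable
    show "AE \<G> in env_law \<mu>. up_gap (shift_env (int n, 0) \<G>) x \<noteq> {} \<longrightarrow> up_gap \<G> x \<noteq> {}"
      using good unfolding gap_shift_empty by eventually_elim (use up_gap_far_right in blast)
  qed (rule prob_shift[OF P])
  then show ?thesis
    using shift_invariant_zero_one[OF P] by fast
qed

text \<open>If both were certain, some \<open>m\<close> would place \<open>x - diag m\<close> in the
  lower gap of \<open>x\<close> and \<open>x + diag m\<close> in its upper gap, each with
  probability above one half. A shift turns the first event into one disjoint from the second up to
  a null set, and the probabilities would add up to more than one.\<close>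

lemma gaps_not_both_certain:
  assumes good: "AE \<G> in env_law \<mu>. good_env \<G>"
  shows "prob {\<G> \<in> space (env_law \<mu>). low_gap \<G> x \<noteq> {}} \<noteq> 1 \<or>
    prob {\<G> \<in> space (env_law \<mu>). up_gap \<G> x \<noteq> {}} \<noteq> 1"
proof (rule ccontr)
  assume "\<not> ?thesis"
  then have one: "prob {\<G> \<in> space (env_law \<mu>). low_gap \<G> x \<noteq> {}} = 1"
    "prob {\<G> \<in> space (env_law \<mu>). up_gap \<G> x \<noteq> {}} = 1" by auto
  define L where "L m = {\<G> \<in> space (env_law \<mu>). x - diag m \<in> low_gap \<G> x}" for m
  define R where "R m = {\<G> \<in> space (env_law \<mu>). x + diag m \<in> up_gap \<G> x}" for m
  have [measurable]: "L m \<in> sets (env_law \<mu>)" "R m \<in> sets (env_law \<mu>)" for m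
    unfolding L_def R_def by measurable
  have "incseq L" unfolding L_def
    by (intro monoI Collect_mono) (auto elim!: low_gap_down simp: site_le_iff)
  then have "(\<lambda>m. prob (L m)) \<longlonglongrightarrow> prob (\<Union>m. L m)"
    by (intro finite_Lim_measure_incseq) auto
  also have "(\<Union>m. L m) = {\<G> \<in> space (env_law \<mu>). low_gap \<G> x \<noteq> {}}"
  proof (intro set_eqI iffI)
    fix \<G> assume G: "\<G> \<in> {\<G> \<in> space (env_law \<mu>). low_gap \<G> x \<noteq> {}}"
    then obtain z where z: "z \<in> low_gap \<G> x" by blast
    have "x - diag (nat (max (fst x - fst z) (snd x - snd z))) \<le> z" by (auto simp: site_le_iff)
    from low_gap_down[OF z this] show "\<G> \<in> (\<Union>m. L m)" using G unfolding L_def by blast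
  qed (auto simp: L_def)
  finally have "(\<lambda>m. prob (L m)) \<longlonglongrightarrow> 1" using one by simp
  then have evL: "eventually (\<lambda>m. prob (L m) > 1 / 2) sequentially" by (rule order_tendstoD) simp
  have "incseq R" unfolding R_def
    by (intro monoI Collect_mono) (auto elim!: up_gap_up simp: site_le_iff)
  then have "(\<lambda>m. prob (R m)) \<longlonglongrightarrow> prob (\<Union>m. R m)"
    by (intro finite_Lim_measure_incseq) auto
  also have "(\<Union>m. R m) = {\<G> \<in> space (env_law \<mu>). up_gap \<G> x \<noteq> {}}"
  proof (intro set_eqI iffI)
    fix \<G> assume G: "\<G> \<in> {\<G> \<in> space (env_law \<mu>). up_gap \<G> x \<noteq> {}}"
    then obtain z where z: "z \<in> up_gap \<G> x" by blast
    have "z \<le> x + diag (nat (max (fst z - fst x) (snd z - snd x)))" by (auto simp: site_le_iff)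
    from up_gap_up[OF z this] show "\<G> \<in> (\<Union>m. R m)" using G unfolding R_def by blast
  qed (auto simp: R_def)
  finally have "(\<lambda>m. prob (R m)) \<longlonglongrightarrow> 1" using one by simp
  then have "eventually (\<lambda>m. prob (R m) > 1 / 2) sequentially" by (rule order_tendstoD) simp
  with evL have "eventually (\<lambda>m. prob (L m) > 1 / 2 \<and> prob (R m) > 1 / 2) sequentially"
    by (rule eventually_conj)
  then obtain m where m: "prob (L m) > 1 / 2" "prob (R m) > 1 / 2"
    using eventually_happens'[OF sequentially_bot] by blast
  \<comment> \<open>The shift by \<open>diag (2 * m)\<close> moves \<open>x - diag m\<close> exactly
    to \<open>x + diag m\<close>, the point tested by \<open>R m\<close>.\<close>
  define L' where "L' = {\<G> \<in> space (env_law \<mu>). x + diag m \<in> low_gap \<G> (x + diag (2 * m))}"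
  have [measurable]: "L' \<in> sets (env_law \<mu>)" unfolding L'_def by measurable
  have eq: "x + diag m = x - diag m + diag (2 * m)" by (simp add: site_eq_iff)
  have "prob L' = prob (L m)"
    unfolding L'_def L_def eq gap_shift[symmetric] by (rule prob_shift) measurable
  have "AE \<G> in env_law \<mu>. \<G> \<in> L' \<longrightarrow> \<G> \<in> space (env_law \<mu>) - R m"
    using good by eventually_elim (use gaps_disjoint[of _ "x + diag m" x "2 * m"] in \<open>auto simp: L'_def R_def\<close>)
  then have "prob L' \<le> prob (space (env_law \<mu>) - R m)"
    by (rule finite_measure_mono_AE) simp
  then have "prob L' \<le> 1 - prob (R m)" by (simp add: prob_compl)
  then show False using m \<open>prob L' = prob (L m)\<close> by simp
qed

end

theorem proposition2p4:
  fixes \<mu> :: "site set measure" and x :: site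
  assumes "is_step_law \<mu>"
    and "measure \<mu> (meets {- e1, e2}) = 1"
    and "measure \<mu> (meets {e1, - e2}) = 1"
    and "measure \<mu> (meets {- e1}) > 0"
    and "measure \<mu> (meets {e1}) > 0"
    and "measure \<mu> (meets {e2}) > 0"
    and "measure \<mu> (meets {- e2}) > 0"
  defines "I \<equiv> env_event \<mu> (\<lambda>\<G>. fills_plane \<G> x)"
    and "II \<equiv> env_event \<mu> (\<lambda>\<G>. fills_above \<G> x)"
    and "III \<equiv> env_event \<mu> (\<lambda>\<G>. fills_below \<G> x)"
  shows "(AE \<G> in env_law \<mu>. fills_plane \<G> x \<or> fills_above \<G> x \<or> fills_below \<G> x) \<and>
    {I, II, III} \<subseteq> sets (env_law \<mu>) \<and>
    (measure (env_law \<mu>) I = 0 \<or> measure (env_law \<mu>) II = 0) \<and>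
    (measure (env_law \<mu>) I = 0 \<or> measure (env_law \<mu>) III = 0) \<and>
    (measure (env_law \<mu>) II = 0 \<or> measure (env_law \<mu>) III = 0)"
proof -
  interpret step_law \<mu> by (rule step_law.intro) fact
  have good: "AE \<G> in env_law \<mu>. good_env \<G>" using assms(2-7) by (rule AE_good_env)
  have sets: "{I, II, III} \<subseteq> sets (env_law \<mu>)"
    unfolding I_def II_def III_def env_event_def by simp
  \<comment> \<open>Whichever alternative holds almost surely, this makes the two others null, since
    the alternatives exclude each other pointwise.\<close>
  have null: "prob (env_event \<mu> Q) = 0"
    if "AE \<G> in env_law \<mu>. P \<G>" "\<And>\<G>. \<not> (P \<G> \<and> Q \<G>)" for P Q
  proof -
    have "AE \<G> in env_law \<mu>. \<not> Q \<G>" using that(1) by eventually_elim (use that(2) in blast)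
    then have "AE \<G> in env_law \<mu>. \<G> \<in> env_event \<mu> Q \<longleftrightarrow> \<G> \<in> {}"
      by eventually_elim (simp add: env_event_def)
    then show ?thesis
      by (cases "env_event \<mu> Q \<in> sets (env_law \<mu>)")
        (use finite_measure_eq_AE[of "env_event \<mu> Q" "{}"] in \<open>auto simp: measure_notin_sets\<close>)
  qed
  let ?L = "prob {\<G> \<in> space (env_law \<mu>). low_gap \<G> x \<noteq> {}}"
  let ?R = "prob {\<G> \<in> space (env_law \<mu>). up_gap \<G> x \<noteq> {}}"
  have AE0: "AE \<G> in env_law \<mu>. low_gap \<G> x = {}" if "?L = 0"
    using that by (subst (asm) prob_Collect_eq_0) auto
  have AE0': "AE \<G> in env_law \<mu>. up_gap \<G> x = {}" if "?R = 0"
    using that by (subst (asm) prob_Collect_eq_0) auto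
  consider "?L = 0" "?R = 0" | "?L = 1" "?R = 0" | "?L = 0" "?R = 1"
    using zero_one_low_gap[OF good, of x] zero_one_up_gap[OF good, of x]
      gaps_not_both_certain[OF good, of x] by auto
  then show ?thesis
  proof cases
    case 1
    have *: "AE \<G> in env_law \<mu>. fills_plane \<G> x"
      using good AE0[OF 1(1)] AE0'[OF 1(2)] by eventually_elim (rule fills_plane_if)
    then have "AE \<G> in env_law \<mu>. fills_plane \<G> x \<or> fills_above \<G> x \<or> fills_below \<G> x"
      by eventually_elim blast
    moreover have "prob II = 0" "prob III = 0"
      unfolding II_def III_def by (rule null[OF *]; use fills_exclusive in blast)+
    ultimately show ?thesis using sets by simp
  next
    case 2
    have "AE \<G> in env_law \<mu>. low_gap \<G> x \<noteq> {}"
      using 2(1) by (subst (asm) prob_Collect_eq_1) auto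
    with good have *: "AE \<G> in env_law \<mu>. fills_above \<G> x"
      using AE0'[OF 2(2)] by eventually_elim (rule fills_above_if)
    then have "AE \<G> in env_law \<mu>. fills_plane \<G> x \<or> fills_above \<G> x \<or> fills_below \<G> x"
      by eventually_elim blast
    moreover have "prob I = 0" "prob III = 0"
      unfolding I_def III_def by (rule null[OF *]; use fills_exclusive in blast)+
    ultimately show ?thesis using sets by simp
  next
    case 3
    have "AE \<G> in env_law \<mu>. up_gap \<G> x \<noteq> {}"
      using 3(2) by (subst (asm) prob_Collect_eq_1) auto
    with good have *: "AE \<G> in env_law \<mu>. fills_below \<G> x"
      using AE0[OF 3(1)] by eventually_elim (rule fills_below_if)
    then have "AE \<G> in env_law \<mu>. fills_plane \<G> x \<or> fills_above \<G> x \<or> fills_below \<G> x"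
      by eventually_elim blast
    moreover have "prob I = 0" "prob II = 0"
      unfolding I_def II_def by (rule null[OF *]; use fills_exclusive in blast)+
    ultimately show ?thesis using sets by simp
  qed
qed

end
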